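(* Consider the nonlinear dynamic program and the AOTD algorithm described in the context. Suppose the reduced-Hessian lower bound, uniform controllability, uniform boundedness, and compactness/smoothness assumptions (all spelled out in the context) hold with $\mu\ge\bar\mu:=32\,\Upsilon_{\rm Upper}^{4t_C+1}/\gamma_C$. Then, at each outer iteration $\tau$ at which the algorithm does not return, the adaptive update rules of AOTD reach, in finitely many (inner) iterations, global parameters $\epsilon^\tau,\eta_1^\tau,\eta_2^\tau$ and local parameters $\{\epsilon_i^\tau\}_{i=0}^{M-1},\{b_i^\tau\}_{i=0}^{M-1}$ for which the composed direction satisfies both the accuracy condition $$\|\bm r(\Delta\tilde{\bm z},\Delta\tilde{\bm\lambda})\|\le\frac{\epsilon^\tau\|\nabla\mathcal L^\tau\|}{\|\Gamma^\tau\|\Psi^\tau}$$ and the descent condition $$(\nabla\mathcal L^\tau_{\bm\eta^\tau})^T\begin{pmatrix}\Delta\tilde{\bm z}\\ \Delta\tilde{\bm\lambda}\end{pmatrix}\le-\frac{\eta_2^\tau}{2}\|\nabla\mathcal L^\tau\|^2$$ simultaneously.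
   Context: **Notation.** $\|\cdot\|$ is the Euclidean norm of vectors and spectral norm of matrices; $\sigma_{\min}$ is the smallest singular value; $\mathbb I$ the identity; $(\bm x;\bm y)$ vertical concatenation. Stages are indexed by subscripts, iterations by superscripts $\tau$. **Problem.** Integers $N,n_x,n_u\ge1$, $\bar{\bm x}_0\in\mathbb R^{n_x}$, functions $g_k:\mathbb R^{n_x}\times\mathbb R^{n_u}\to\mathbb R$, $f_k:\mathbb R^{n_x}\times\mathbb R^{n_u}\to\mathbb R^{n_x}$ ($0\le k\le N-1$), $g_N:\mathbb R^{n_x}\to\mathbb R$. The problem is to minimize $\sum_{k=0}^{N-1}g_k(\bm x_k,\bm u_k)+g_N(\bm x_N)$ subject to $\bm x_0=\bar{\bm x}_0$, $\bm x_{k+1}=f_k(\bm x_k,\bm u_k)$. Put $\bm z_k=(\bm x_k;\bm u_k)$ for $k<N$, $\bm z_N=\bm x_N$, $\bm z=(\bm z_0;\dots;\bm z_N)$; $g(\bm z)$ is the total cost, $f(\bm z)=(\bm x_0-\bar{\bm x}_0;\ \bm x_1-f_0(\bm x_0,\bm u_0);\dots;\bm x_N-f_{N-1}(\bm x_{N-1},\bm u_{N-1}))$, $\bm\lambda=(\bm\lambda_0;\dots;\bm\lambda_N)$ with $\bm\lambda_k\in\mathbb R^{n_x}$, $\mathcal L(\bm z,\bm\lambda)=g(\bm z)+\bm\lambda^Tf(\bm z)$, $\nabla\mathcal L=(\nabla_{\bm z}\mathcal L;\nabla_{\bm\lambda}\mathcal L)$. A superscript $\tau$ denotes evaluation at $(\bm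 z^\tau,\bm\lambda^\tau)$. $A_k,B_k$ are the Jacobians of $f_k$ in $\bm x_k,\bm u_k$; $G$ is the Jacobian of $f$; $H=\nabla^2_{\bm z}\mathcal L=\mathrm{diag}(H_0,\dots,H_N)$, where $H_k$ depends on $(\bm z_k,\bm\lambda_{k+1})$ for $k<N$ and $H_N$ on $\bm z_N$. $\hat H^\tau=\mathrm{diag}(\hat H_0^\tau,\dots,\hat H_N^\tau)$ is a symmetric modification of $H^\tau$ with the same block structure, $\hat H_k^\tau=\begin{pmatrix}\hat Q_k&\hat S_k^T\\ \hat S_k&\hat R_k\end{pmatrix}$ ($k<N$), $\hat H_N^\tau=\hat Q_N$, with $\hat H^\tau=H^\tau$ whenever $H^\tau$ itself satisfies the reduced-Hessian lower bound below. $\Gamma^\tau=\begin{pmatrix}\hat H^\tau&(G^\tau)^T\\ G^\tau&\bm0\end{pmatrix}$. The exact Newton direction $(\Delta\bm z^\tau,\Delta\bm\lambda^\tau)$ solves $\Gamma^\tau(\Delta\bm z^\tau;\Delta\bm\lambda^\tau)=-\nabla\mathcal L^\tau$. **Merit function.** For $\bm\eta=(\eta_1,\eta_2)$ positive, $\mathcal L_{\bm\eta}=\mathcal L+\frac{\eta_1}2\|\nabla_{\bm\lambda}\mathcal L\|^2+\frac{\eta_2}2\|\nabla_{\bm z}\mathcal L\|^2$; $\mathcal L^\tau_{\bm\eta}=\mathcal L_{\bm\eta}(\bm z^\tau,\bm\lambda^\tau)$. **Decomposition.** $M\in\{1,\dots,N\}$, knots $0=n_0<\dots<n_M=N$, cores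 $\mathcal K_i=\{n_i,\dots,n_{i+1}-1\}$ for $i<M-1$ and $\mathcal K_{M-1}=\{n_{M-1},\dots,N\}$. Given nominal overlap $b_i\in\mathbb Z_{\ge1}$, subproblem $i\in\{0,\dots,M-1\}$ has window $[m_1,m_2]$, $m_1=m_1^i=\max\{n_i-b_i,0\}$, $m_2=m_2^i=\min\{n_{i+1}+b_i,N\}$. With a fixed $\mu>0$, the local quadratic program at iteration $\tau$, in $\bm p_k\in\mathbb R^{n_x}$ ($m_1\le k\le m_2$), $\bm q_k\in\mathbb R^{n_u}$ ($m_1\le k<m_2$), minimizes $$\sum_{k=m_1}^{m_2-1}\Big\{\tfrac12\begin{pmatrix}\bm p_k\\\bm q_k\end{pmatrix}^T\hat H_k^\tau\begin{pmatrix}\bm p_k\\\bm q_k\end{pmatrix}+(\nabla_{\bm x_k}\mathcal L^\tau)^T\bm p_k+(\nabla_{\bm u_k}\mathcal L^\tau)^T\bm q_k\Big\}+\tfrac12\bm p_{m_2}^T\hat H_{\rm T}\bm p_{m_2}+(\nabla_{\bm x_{m_2}}\mathcal L^\tau)^T\bm p_{m_2},$$ $\hat H_{\rm T}=\hat Q_{m_2}+\mu\mathbb I$ if $m_2<N$ and $\hat Q_N$ if $m_2=N$, subject to $\bm p_{m_1}=\bm d_1$ and $\bm p_{k+1}=A_k^\tau\bm p_k+B_k^\tau\bm q_k-\nabla_{\bm\lambda_{k+1}}\mathcal L^\tau$ for $m_1\le k<m_2$, where $\bm d_1=\bar{\bm x}_0-\bm x_0^\tau$ if $m_1=0$ and $\bm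 d_1=\bm0$ otherwise. Let $\tilde{\bm\omega}$ stack the $\bm p_k,\bm q_k$ and $\tilde{\bm\zeta}=(\bm\zeta_{m_1};\dots;\bm\zeta_{m_2})$ stack the multipliers (Lagrangian = objective $+\bm\zeta_{m_1}^T(\bm p_{m_1}-\bm d_1)+\sum_k\bm\zeta_{k+1}^T(\bm p_{k+1}-A_k^\tau\bm p_k-B_k^\tau\bm q_k+\nabla_{\bm\lambda_{k+1}}\mathcal L^\tau)$). The KKT system is $\Gamma_i^\tau(\tilde{\bm\omega};\tilde{\bm\zeta})=-\nabla\mathcal L^{(i),\tau}_{\rm QP}$, where $\nabla\mathcal L^{(i),\tau}_{\rm QP}$ is the gradient of this Lagrangian at $(\bm0,\bm0)$ and $\Gamma_i^\tau$ its Hessian. A local solve with tolerance $\epsilon_i^\tau>0$ returns any $(\Delta\tilde{\bm\omega}_i,\Delta\tilde{\bm\zeta}_i)$ with $$\big\|\Gamma_i^\tau(\Delta\tilde{\bm\omega}_i;\Delta\tilde{\bm\zeta}_i)+\nabla\mathcal L^{(i),\tau}_{\rm QP}\big\|\le\epsilon_i^\tau\|\nabla\mathcal L^{(i),\tau}_{\rm QP}\|\quad\text{(local residual condition)};$$ local solvers are assumed to achieve this for any $\epsilon_i^\tau>0$ in finitely many iterations (almost surely if randomized). The composed direction $(\Delta\tilde{\bm z},\Delta\tilde{\bm\lambda})$ takes its stage-$k$ primal and dual components from local solution $i$ whenever $k\in\mathcal K_i$ (dual increments being the $\bm\zeta_k$). **Tests.** $\bm r=\bm r(\Delta\tilde{\bm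 z},\Delta\tilde{\bm\lambda})=\Gamma^\tau(\Delta\tilde{\bm z};\Delta\tilde{\bm\lambda})+\nabla\mathcal L^\tau$, and $\bm r_i$ its restriction to $\mathcal K_i$. Accuracy condition: $\|\bm r\|\le\epsilon^\tau\|\nabla\mathcal L^\tau\|/(\|\Gamma^\tau\|\Psi^\tau)$ with $\Psi^\tau=\dfrac{20\max(\|\hat H^\tau\|^2,1)}{\min\{\gamma_{\rm RH},1\}\min\{\sigma_{\min}(G^\tau)^2,1\}}$. Descent condition: $(\nabla\mathcal L^\tau_{\bm\eta^\tau})^T(\Delta\tilde{\bm z};\Delta\tilde{\bm\lambda})\le-\eta_2^\tau\|\nabla\mathcal L^\tau\|^2/2$. Cap: $\epsilon^\tau_{\max}=\dfrac{(0.5-\beta)\eta_2^\tau}{(1+\eta_1^\tau+\eta_2^\tau)(\Psi^\tau\Upsilon^\tau)^2}$, $\Upsilon^\tau=\max\{\|G^\tau\|,\|\hat H^\tau\|,1\}$. **AOTD algorithm.** Inputs: $(\bm z^0,\bm\lambda^0)$, $\eta_1^0,\eta_2^0,\epsilon^0,\epsilon_i^0>0$, $b_i^0\in\mathbb Z_{\ge1}$, $\beta\in(0,0.5)$, $\delta\in(0,1)$, $\varrho_b,\varrho_\epsilon>0$, $\nu>1$, $\mu>0$, $\mathrm{tol}_{\rm KKT}\ge0$. For $\tau=0,1,2,\dots$: (i) if $\|\nabla\mathcal L^\tau\|\le\mathrm{tol}_{\rm KKT}$, return. (ii) If $\epsilon^\tau>\epsilon^\tau_{\max}$, set $\epsilon^\tau\gets\epsilon^\tau_{\max}/\nu$.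 Set the direction to $\bm0$. (iii) While the accuracy or the descent condition fails: [accuracy loop] while accuracy fails, perform all local solves with current $b_i^\tau,\epsilon_i^\tau$, compose, and, if accuracy still fails, update for all $i$ $$\epsilon_i^\tau\gets\epsilon_i^\tau\exp\!\Big(-\varrho_\epsilon\Big[\tfrac{\|\bm r_i\|}{\|\bm r\|}+\tfrac1{\sqrt M}\Big]\Big),\qquad b_i^\tau\gets b_i^\tau+\max\Big\{1,\Big\lceil\varrho_b\tfrac{\|\bm r_i\|}{\|\bm r\|}\Big\rceil\Big\};$$ then, if descent fails, set $\eta_1^\tau\gets\nu^2\eta_1^\tau$, $\eta_2^\tau\gets\eta_2^\tau/\nu$, recompute $\epsilon^\tau_{\max}$, and set $\epsilon^\tau\gets\min\{\epsilon^\tau_{\max},\epsilon^\tau/\nu^4\}$. (iv) Accept the direction as $(\Delta\tilde{\bm z}^\tau,\Delta\tilde{\bm\lambda}^\tau)$; backtrack $\alpha^\tau=1,\delta,\delta^2,\dots$ until the Armijo condition $\mathcal L_{\bm\eta^\tau}((\bm z^\tau;\bm\lambda^\tau)+\alpha^\tau(\Delta\tilde{\bm z}^\tau;\Delta\tilde{\bm\lambda}^\tau))\le\mathcal L^\tau_{\bm\eta^\tau}+\alpha^\tau\beta(\nabla\mathcal L^\tau_{\bm\eta^\tau})^T(\Delta\tilde{\bm z}^\tau;\Delta\tilde{\bm\lambda}^\tau)$ holds; set $(\bm z^{\tau+1};\bm\lambda^{\tau+1})=(\bm z^\tau;\bm\lambda^\tau)+\alpha^\tau(\Delta\tilde{\bm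 z}^\tau;\Delta\tilde{\bm\lambda}^\tau)$; carry $\eta_1^\tau,\eta_2^\tau,\epsilon^\tau,\epsilon_i^\tau,b_i^\tau$ to iteration $\tau+1$. **Assumptions** (constants independent of $\tau$). *Reduced-Hessian lower bound:* there is $\gamma_{\rm RH}>0$ (the constant used in $\Psi^\tau$) with $(Z^\tau)^T\hat H^\tau Z^\tau\succeq\gamma_{\rm RH}\mathbb I$ for all $\tau\ge0$, where the columns of $Z^\tau$ form an orthonormal basis of $\ker G^\tau$. *Uniform controllability:* there are $\gamma_C\in(0,1]$ and $t_C\in\{1,\dots,N\}$ such that for all $\tau\ge0$ and $0\le k\le N-t_C$ there is an integer $t=t_k^\tau\in[1,t_C]$ with $\Xi\Xi^T\succeq\gamma_C\mathbb I$, $\Xi=[B_{k+t-1},\ A_{k+t-1}B_{k+t-2},\ \dots,\ A_{k+t-1}\cdots A_{k+1}B_k]$ evaluated at $\bm z^\tau$. *Uniform boundedness:* there is $\Upsilon_{\rm Upper}\ge2$ with $\|\hat H_k^\tau\|,\|A_k^\tau\|,\|B_k^\tau\|\le\Upsilon_{\rm Upper}$ for $0\le k\le N-1$ and $\|\hat H_N^\tau\|\le\Upsilon_{\rm Upper}$, all $\tau\ge0$. *Compactness/smoothness:* there is a compact set $\mathcal Z\times\Lambda$, $\mathcal Z=\mathcal Z_0\times\dots\times\mathcal Z_N$, $\Lambda=\Lambda_0\times\dots\times\Lambda_N$, containing $(\bm z^\tau+\alpha\Delta\tilde{\bm z}^\tau,\bm\lambda^\tau+\alpha\Delta\tilde{\bm\lambda}^\tau)$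 for all $\tau\ge0$, $\alpha\in[0,1]$; $g_k,g_N,f_k$ are three times continuously differentiable; and for $0\le k\le N-1$, $\sup_{\mathcal Z_k\times\Lambda_{k+1}}\|H_k\|$, $\sup_{\mathcal Z_k}\|A_k\|$, $\sup_{\mathcal Z_k}\|B_k\|$, and $\sup_{\mathcal Z_N}\|H_N\|$ are all $\le\Upsilon_{\rm Upper}$ (same constant). *)

theory Defs
  imports "HOL-Analysis.Analysis"
begin

section \<open>Calculus and linear algebra on Euclidean spaces\<close>

definition grad :: "('a::real_inner \<Rightarrow> real) \<Rightarrow> 'a \<Rightarrow> 'a" where
  "grad F a = (THE D. GDERIV F a :> D)"

definition hess :: "('a::real_inner \<Rightarrow> real) \<Rightarrow> 'a \<Rightarrow> 'a \<Rightarrow> 'a" where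
  "hess F a = frechet_derivative (grad F) (at a)"

text \<open>\<open>Ck m F\<close>: \<open>F\<close> is \<open>m\<close> times continuously differentiable on the whole (finite-dimensional) space.\<close>

primrec Ck :: "nat \<Rightarrow> ('a::euclidean_space \<Rightarrow> 'b::euclidean_space) \<Rightarrow> bool" where
  "Ck 0 F \<longleftrightarrow> continuous_on UNIV F"
| "Ck (Suc m) F \<longleftrightarrow>
     (\<forall>x. F differentiable (at x)) \<and> (\<forall>v. Ck m (\<lambda>x. frechet_derivative F (at x) v))"

text \<open>
  Matrices are represented by linear maps: the transpose is \<open>adjoint\<close>, the spectral norm \<open>onorm\<close>.
  The singular values of a map whose codomain has at most the dimension of its domain (such as the
  constraint Jacobian below) are the square roots of the eigenvalues of \<open>T T\<^sup>T\<close>.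
\<close>

definition singular_values :: "('a::euclidean_space \<Rightarrow> 'b::euclidean_space) \<Rightarrow> real set" where
  "singular_values T = {s. 0 \<le> s \<and> (\<exists>v. v \<noteq> 0 \<and> T (adjoint T v) = s\<^sup>2 *\<^sub>R v)}"

definition sigma_min :: "('a::euclidean_space \<Rightarrow> 'b::euclidean_space) \<Rightarrow> real" where
  "sigma_min T = Inf (singular_values T)"

definition symmetric_map :: "('a::euclidean_space \<Rightarrow> 'a) \<Rightarrow> bool" where
  "symmetric_map T \<longleftrightarrow> linear T \<and> adjoint T = T"

text \<open>
  \<open>Z\<^sup>T H Z \<succeq> \<gamma> I\<close>, where the columns of \<open>Z\<close>, here the elements of the set \<open>B\<close>, form an orthonormal
  basis of the kernel of \<open>G\<close>. The entries of \<open>Z\<^sup>T H Z\<close> are the numbers \<open>b \<bullet> H b'\<close>.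
\<close>

definition reduced_hessian_ge ::
  "('a::euclidean_space \<Rightarrow> 'b::euclidean_space) \<Rightarrow> ('a \<Rightarrow> 'a) \<Rightarrow> real \<Rightarrow> bool" where
  "reduced_hessian_ge G H \<gamma> \<longleftrightarrow>
     (\<exists>B. finite B \<and> pairwise orthogonal B \<and> (\<forall>b\<in>B. norm b = 1) \<and> span B = {w. G w = 0} \<and>
          (\<forall>c. (\<Sum>b\<in>B. \<Sum>b'\<in>B. c b * c b' * (b \<bullet> H b')) \<ge> \<gamma> * (\<Sum>b\<in>B. (c b)\<^sup>2)))"


section \<open>Stage-indexed vectors\<close>

text \<open>
  The horizon is \<open>N = CARD('n) \<ge> 1\<close>; states and multipliers are indexed by the \<open>N + 1\<close> elements of
  \<open>'n option\<close>, controls by the \<open>N\<close> elements of \<open>'n\<close>. So the stacked spaces are Euclidean spaces.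
  Stage numbers \<open>0, 1, \<dots>\<close> are attached to the elements of a finite index type by the
  library's enumeration; which one is used is immaterial, and numbers beyond the last stage never matter.
\<close>

type_synonym ('n, 'x, 'u) primal = "((real ^ 'x) ^ ('n option)) \<times> ((real ^ 'u) ^ 'n)"
type_synonym ('n, 'x) dual = "(real ^ 'x) ^ ('n option)"
type_synonym ('n, 'x, 'u) pd = "('n, 'x, 'u) primal \<times> ('n, 'x) dual"
type_synonym ('x, 'u) xu = "(real ^ 'x) \<times> (real ^ 'u)"

definition stage :: "nat \<Rightarrow> 'i::finite" where
  "stage = from_nat_into UNIV"

definition stage_no :: "'i::finite \<Rightarrow> nat" where
  "stage_no = to_nat_on UNIV"

definition xc :: "nat \<Rightarrow> ('n::finite, 'x::finite, 'u::finite) primal \<Rightarrow> real ^ 'x" where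
  "xc k z = fst z $ stage k"

definition uc :: "nat \<Rightarrow> ('n::finite, 'x::finite, 'u::finite) primal \<Rightarrow> real ^ 'u" where
  "uc k z = snd z $ stage k"

definition zc :: "nat \<Rightarrow> ('n::finite, 'x::finite, 'u::finite) primal \<Rightarrow> ('x, 'u) xu" where
  "zc k z = (xc k z, uc k z)"

definition lc :: "nat \<Rightarrow> ('n::finite, 'x::finite) dual \<Rightarrow> real ^ 'x" where
  "lc k l = l $ stage k"

definition restrict_stages ::
  "nat set \<Rightarrow> ('n::finite, 'x::finite, 'u::finite) pd \<Rightarrow> ('n, 'x, 'u) pd" where
  "restrict_stages K w =
     (((\<chi> a. if stage_no a \<in> K then fst (fst w) $ a else 0),
       (\<chi> a. if stage_no a \<in> K then snd (fst w) $ a else 0)),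
      (\<chi> a. if stage_no a \<in> K then snd w $ a else 0))"


section \<open>The nonlinear dynamic program\<close>

record ('x, 'u) ocp =
  x0bar :: "real ^ 'x"
  cost :: "nat \<Rightarrow> ('x, 'u) xu \<Rightarrow> real"
  costN :: "real ^ 'x \<Rightarrow> real"
  dyn :: "nat \<Rightarrow> ('x, 'u) xu \<Rightarrow> real ^ 'x"

definition total_cost ::
  "('x::finite, 'u::finite) ocp \<Rightarrow> ('n::finite, 'x, 'u) primal \<Rightarrow> real" where
  "total_cost P z = (\<Sum>k<CARD('n). cost P k (zc k z)) + costN P (xc CARD('n) z)"

definition constr ::
  "('x::finite, 'u::finite) ocp \<Rightarrow> ('n::finite, 'x, 'u) primal \<Rightarrow> ('n, 'x) dual" where
  "constr P z =
     (\<chi> a. case stage_no a of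
             0 \<Rightarrow> xc 0 z - x0bar P
           | Suc k \<Rightarrow> xc (Suc k) z - dyn P k (zc k z))"

definition lagr ::
  "('x::finite, 'u::finite) ocp \<Rightarrow> ('n::finite, 'x, 'u) pd \<Rightarrow> real" where
  "lagr P w = total_cost P (fst w) + snd w \<bullet> constr P (fst w)"

definition grad_z ::
  "('x::finite, 'u::finite) ocp \<Rightarrow> ('n::finite, 'x, 'u) pd \<Rightarrow> ('n, 'x, 'u) primal" where
  "grad_z P w = grad (\<lambda>z. lagr P (z, snd w)) (fst w)"

definition grad_l ::
  "('x::finite, 'u::finite) ocp \<Rightarrow> ('n::finite, 'x, 'u) pd \<Rightarrow> ('n, 'x) dual" where
  "grad_l P w = grad (\<lambda>l. lagr P (fst w, l)) (snd w)"

definition grad_L ::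
  "('x::finite, 'u::finite) ocp \<Rightarrow> ('n::finite, 'x, 'u) pd \<Rightarrow> ('n, 'x, 'u) pd" where
  "grad_L P w = (grad_z P w, grad_l P w)"

definition hess_z ::
  "('x::finite, 'u::finite) ocp \<Rightarrow> ('n::finite, 'x, 'u) pd \<Rightarrow> ('n, 'x, 'u) primal \<Rightarrow> ('n, 'x, 'u) primal"
  where "hess_z P w = hess (\<lambda>z. lagr P (z, snd w)) (fst w)"

definition jac_f ::
  "('x::finite, 'u::finite) ocp \<Rightarrow> ('n::finite, 'x, 'u) primal \<Rightarrow> ('n, 'x, 'u) primal \<Rightarrow> ('n, 'x) dual"
  where "jac_f P z = frechet_derivative (constr P) (at z)"

definition jac_A ::
  "('x::finite, 'u::finite) ocp \<Rightarrow> nat \<Rightarrow> ('x, 'u) xu \<Rightarrow> real ^ 'x \<Rightarrow> real ^ 'x" where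
  "jac_A P k y = frechet_derivative (\<lambda>x. dyn P k (x, snd y)) (at (fst y))"

definition jac_B ::
  "('x::finite, 'u::finite) ocp \<Rightarrow> nat \<Rightarrow> ('x, 'u) xu \<Rightarrow> real ^ 'u \<Rightarrow> real ^ 'x" where
  "jac_B P k y = frechet_derivative (\<lambda>u. dyn P k (fst y, u)) (at (snd y))"

text \<open>The diagonal blocks \<open>H\<^sub>k\<close> (for \<open>k < N\<close>) and \<open>H\<^sub>N\<close> of an operator on the primal space.\<close>

definition diag_block ::
  "nat \<Rightarrow> (('n::finite, 'x::finite, 'u::finite) primal \<Rightarrow> ('n, 'x, 'u) primal) \<Rightarrow> ('x, 'u) xu \<Rightarrow> ('x, 'u) xu"
  where "diag_block k T y = zc k (T (axis (stage k) (fst y), axis (stage k) (snd y)))"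

definition diag_blockN ::
  "(('n::finite, 'x::finite, 'u::finite) primal \<Rightarrow> ('n, 'x, 'u) primal) \<Rightarrow> real ^ 'x \<Rightarrow> real ^ 'x"
  where "diag_blockN T p = xc CARD('n) (T (axis (stage CARD('n)) p, 0))"

text \<open>
  The modified Hessian is given by its diagonal blocks: the maps for stages \<open>k < N\<close> and the one for stage \<open>N\<close>.
\<close>

type_synonym ('x, 'u) hblocks =
  "(nat \<Rightarrow> ('x, 'u) xu \<Rightarrow> ('x, 'u) xu) \<times> (real ^ 'x \<Rightarrow> real ^ 'x)"

definition block_diag ::
  "('x::finite, 'u::finite) hblocks \<Rightarrow> ('n::finite, 'x, 'u) primal \<Rightarrow> ('n, 'x, 'u) primal" where
  "block_diag Hb z =
     ((\<chi> a. if stage_no a < CARD('n) then fst (fst Hb (stage_no a) (zc (stage_no a) z))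
             else snd Hb (xc CARD('n) z)),
      (\<chi> a. snd (fst Hb (stage_no a) (zc (stage_no a) z))))"

text \<open>The operator of the matrix with blocks \<open>H, G\<^sup>T; G, 0\<close>.\<close>

definition kkt_map ::
  "('a::euclidean_space \<Rightarrow> 'a) \<Rightarrow> ('a \<Rightarrow> 'b::euclidean_space) \<Rightarrow> 'a \<times> 'b \<Rightarrow> 'a \<times> 'b" where
  "kkt_map H G w = (H (fst w) + adjoint G (snd w), G (fst w))"

definition Gam ::
  "('x::finite, 'u::finite) ocp \<Rightarrow> ('x, 'u) hblocks \<Rightarrow> ('n::finite, 'x, 'u) pd \<Rightarrow> ('n, 'x, 'u) pd \<Rightarrow> ('n, 'x, 'u) pd"
  where "Gam P Hb w = kkt_map (block_diag Hb) (jac_f P (fst w))"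

definition merit ::
  "('x::finite, 'u::finite) ocp \<Rightarrow> real \<Rightarrow> real \<Rightarrow> ('n::finite, 'x, 'u) pd \<Rightarrow> real" where
  "merit P \<eta>1 \<eta>2 w = lagr P w + \<eta>1 / 2 * (norm (grad_l P w))\<^sup>2 + \<eta>2 / 2 * (norm (grad_z P w))\<^sup>2"

text \<open>
  \<open>Aprod P z a m = A\<^bsub>a+m-1\<^esub> \<cdots> A\<^bsub>a\<^esub>\<close>; \<open>ctrl_block P z k t j\<close> is the block
  \<open>A\<^bsub>k+t-1\<^esub> \<cdots> A\<^bsub>k+j+1\<^esub> B\<^bsub>k+j\<^esub>\<close> of the controllability matrix \<open>\<Xi>\<close> (\<open>j < t\<close>),
  so that \<open>\<Xi> \<Xi>\<^sup>T\<close> is the sum of the block Gramians.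
\<close>

primrec Aprod ::
  "('x::finite, 'u::finite) ocp \<Rightarrow> ('n::finite, 'x, 'u) primal \<Rightarrow> nat \<Rightarrow> nat \<Rightarrow> real ^ 'x \<Rightarrow> real ^ 'x" where
  "Aprod P z a 0 = id"
| "Aprod P z a (Suc m) = jac_A P (a + m) (zc (a + m) z) \<circ> Aprod P z a m"

definition ctrl_block ::
  "('x::finite, 'u::finite) ocp \<Rightarrow> ('n::finite, 'x, 'u) primal \<Rightarrow> nat \<Rightarrow> nat \<Rightarrow> nat \<Rightarrow> real ^ 'u \<Rightarrow> real ^ 'x" where
  "ctrl_block P z k t j = Aprod P z (k + j + 1) (t - 1 - j) \<circ> jac_B P (k + j) (zc (k + j) z)"

definition ctrl_gram ::
  "('x::finite, 'u::finite) ocp \<Rightarrow> ('n::finite, 'x, 'u) primal \<Rightarrow> nat \<Rightarrow> nat \<Rightarrow> real ^ 'x \<Rightarrow> real ^ 'x" where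
  "ctrl_gram P z k t v = (\<Sum>j<t. ctrl_block P z k t j (adjoint (ctrl_block P z k t j) v))"


section \<open>Algorithm data and overlapping decomposition\<close>

record aotd_params =
  parts :: nat
  knot :: "nat \<Rightarrow> nat"
  beta :: real
  delta :: real
  rho_b :: real
  rho_e :: real
  nu :: real
  mu :: real
  tol_kkt :: real
  gam_RH :: real

definition valid_params :: "nat \<Rightarrow> aotd_params \<Rightarrow> bool" where
  "valid_params N c \<longleftrightarrow>
     parts c \<in> {1..N} \<and> knot c 0 = 0 \<and> knot c (parts c) = N \<and> strict_mono_on {0..parts c} (knot c) \<and>
     beta c \<in> {0<..<1/2} \<and> delta c \<in> {0<..<1} \<and> rho_b c > 0 \<and> rho_e c > 0 \<and> nu c > 1 \<and>
     mu c > 0 \<and> tol_kkt c \<ge> 0 \<and> gam_RH c > 0"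

definition core :: "nat \<Rightarrow> aotd_params \<Rightarrow> nat \<Rightarrow> nat set" where
  "core N c i = (if i < parts c - 1 then {knot c i..<knot c (i + 1)} else {knot c i..N})"

definition owner :: "nat \<Rightarrow> aotd_params \<Rightarrow> nat \<Rightarrow> nat" where
  "owner N c k = (THE i. i < parts c \<and> k \<in> core N c i)"

text \<open>Truncated subtraction on \<open>nat\<close> is the required maximum with \<open>0\<close>.\<close>

definition win_lo :: "aotd_params \<Rightarrow> nat \<Rightarrow> nat \<Rightarrow> nat" where
  "win_lo c i b = knot c i - b"

definition win_hi :: "nat \<Rightarrow> aotd_params \<Rightarrow> nat \<Rightarrow> nat \<Rightarrow> nat" where
  "win_hi N c i b = min (knot c (i + 1) + b) N"

text \<open>
  The Lagrangian of the local quadratic program on the window \<open>[m1, m2]\<close>, linearised at \<open>w\<close>, as a function of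
  \<open>v = (\<omega>, \<zeta>)\<close>. Window vectors are written as full stage-indexed vectors; this function ignores the components
  outside the window (the control at stage \<open>m2\<close> included), so its gradient and Hessian vanish there and coincide,
  norms included, with those on the window.
\<close>

definition qp_lagr ::
  "('x::finite, 'u::finite) ocp \<Rightarrow> real \<Rightarrow> ('x, 'u) hblocks \<Rightarrow> ('n::finite, 'x, 'u) pd \<Rightarrow> nat \<Rightarrow> nat \<Rightarrow>
     ('n, 'x, 'u) pd \<Rightarrow> real" where
  "qp_lagr P m Hb w m1 m2 v =
    (let z = fst w; gz = grad_z P w; gl = grad_l P w; \<omega> = fst v; \<zeta> = snd v;
         HT = (\<lambda>p. if m2 < CARD('n) then fst (fst Hb m2 (p, 0)) + m *\<^sub>R p else snd Hb p);
         d1 = (if m1 = 0 then x0bar P - xc 0 z else 0)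
     in (\<Sum>k=m1..<m2. 1/2 * (zc k \<omega> \<bullet> fst Hb k (zc k \<omega>)) + xc k gz \<bullet> xc k \<omega> + uc k gz \<bullet> uc k \<omega>)
        + 1/2 * (xc m2 \<omega> \<bullet> HT (xc m2 \<omega>)) + xc m2 gz \<bullet> xc m2 \<omega>
        + lc m1 \<zeta> \<bullet> (xc m1 \<omega> - d1)
        + (\<Sum>k=m1..<m2. lc (k + 1) \<zeta> \<bullet>
             (xc (k + 1) \<omega> - jac_A P k (zc k z) (xc k \<omega>) - jac_B P k (zc k z) (uc k \<omega>) + lc (k + 1) gl)))"

text \<open>\<open>v\<close> is an admissible outcome of the local solve of subproblem \<open>i\<close> with overlap \<open>b\<close> and tolerance \<open>e\<close>.\<close>

definition local_solution ::
  "('x::finite, 'u::finite) ocp \<Rightarrow> aotd_params \<Rightarrow> ('x, 'u) hblocks \<Rightarrow> ('n::finite, 'x, 'u) pd \<Rightarrow>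
     nat \<Rightarrow> nat \<Rightarrow> real \<Rightarrow> ('n, 'x, 'u) pd \<Rightarrow> bool" where
  "local_solution P c Hb w i b e v \<longleftrightarrow>
    (let Q = qp_lagr P (mu c) Hb w (win_lo c i b) (win_hi CARD('n) c i b)
     in norm (hess Q 0 v + grad Q 0) \<le> e * norm (grad Q 0))"

definition composed ::
  "aotd_params \<Rightarrow> (nat \<Rightarrow> ('n::finite, 'x::finite, 'u::finite) pd) \<Rightarrow> ('n, 'x, 'u) pd" where
  "composed c y =
    (let o_of = (\<lambda>k. y (owner CARD('n) c k))
     in (((\<chi> a. fst (fst (o_of (stage_no a))) $ a), (\<chi> a. snd (fst (o_of (stage_no a))) $ a)),
         (\<chi> a. snd (o_of (stage_no a)) $ a)))"


section \<open>The AOTD algorithm\<close>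

text \<open>
  \<open>iterate\<close> is the current primal-dual point, \<open>dirn\<close> the current search direction; \<open>eps_loc i\<close> and \<open>ovl i\<close> are the
  tolerance and the overlap of subproblem \<open>i\<close>.
\<close>

record ('n, 'x, 'u) aotd_state =
  iterate :: "('n, 'x, 'u) pd"
  eta1 :: real
  eta2 :: real
  eps :: real
  eps_loc :: "nat \<Rightarrow> real"
  ovl :: "nat \<Rightarrow> nat"
  dirn :: "('n, 'x, 'u) pd"

definition valid_init :: "aotd_params \<Rightarrow> ('n::finite, 'x::finite, 'u::finite) aotd_state \<Rightarrow> bool" where
  "valid_init c s \<longleftrightarrow> eta1 s > 0 \<and> eta2 s > 0 \<and> eps s > 0 \<and> (\<forall>i<parts c. eps_loc s i > 0 \<and> ovl s i \<ge> 1)"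

definition Psi ::
  "('x::finite, 'u::finite) ocp \<Rightarrow> aotd_params \<Rightarrow> ('x, 'u) hblocks \<Rightarrow> ('n::finite, 'x, 'u) pd \<Rightarrow> real" where
  "Psi P c Hb w =
     20 * max ((onorm (block_diag Hb :: ('n, 'x, 'u) primal \<Rightarrow> _))\<^sup>2) 1
       / (min (gam_RH c) 1 * min ((sigma_min (jac_f P (fst w)))\<^sup>2) 1)"

definition Upsilon ::
  "('x::finite, 'u::finite) ocp \<Rightarrow> ('x, 'u) hblocks \<Rightarrow> ('n::finite, 'x, 'u) pd \<Rightarrow> real" where
  "Upsilon P Hb w =
     max (onorm (jac_f P (fst w))) (max (onorm (block_diag Hb :: ('n, 'x, 'u) primal \<Rightarrow> _)) 1)"

definition eps_max ::
  "('x::finite, 'u::finite) ocp \<Rightarrow> aotd_params \<Rightarrow> ('x, 'u) hblocks \<Rightarrow> ('n::finite, 'x, 'u) aotd_state \<Rightarrow> real" where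
  "eps_max P c Hb s =
     (1/2 - beta c) * eta2 s
       / ((1 + eta1 s + eta2 s) * (Psi P c Hb (iterate s) * Upsilon P Hb (iterate s))\<^sup>2)"

definition resid ::
  "('x::finite, 'u::finite) ocp \<Rightarrow> ('x, 'u) hblocks \<Rightarrow> ('n::finite, 'x, 'u) aotd_state \<Rightarrow> ('n, 'x, 'u) pd" where
  "resid P Hb s = Gam P Hb (iterate s) (dirn s) + grad_L P (iterate s)"

definition accuracy ::
  "('x::finite, 'u::finite) ocp \<Rightarrow> aotd_params \<Rightarrow> ('x, 'u) hblocks \<Rightarrow> ('n::finite, 'x, 'u) aotd_state \<Rightarrow> bool" where
  "accuracy P c Hb s \<longleftrightarrow>
     norm (resid P Hb s)
       \<le> eps s * norm (grad_L P (iterate s)) / (onorm (Gam P Hb (iterate s)) * Psi P c Hb (iterate s))"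

definition descent ::
  "('x::finite, 'u::finite) ocp \<Rightarrow> ('n::finite, 'x, 'u) aotd_state \<Rightarrow> bool" where
  "descent P s \<longleftrightarrow>
     grad (merit P (eta1 s) (eta2 s)) (iterate s) \<bullet> dirn s
       \<le> - (eta2 s * (norm (grad_L P (iterate s)))\<^sup>2 / 2)"

definition begin_iteration ::
  "('x::finite, 'u::finite) ocp \<Rightarrow> aotd_params \<Rightarrow> ('x, 'u) hblocks \<Rightarrow>
     ('n::finite, 'x, 'u) aotd_state \<Rightarrow> ('n, 'x, 'u) aotd_state" where
  "begin_iteration P c Hb s =
     s\<lparr>eps := (if eps s > eps_max P c Hb s then eps_max P c Hb s / nu c else eps s), dirn := 0\<rparr>"

text \<open>One pass of the accuracy loop, in which the local solvers return \<open>y\<close>.\<close>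

definition accuracy_pass ::
  "('x::finite, 'u::finite) ocp \<Rightarrow> aotd_params \<Rightarrow> ('x, 'u) hblocks \<Rightarrow> (nat \<Rightarrow> ('n::finite, 'x, 'u) pd) \<Rightarrow>
     ('n, 'x, 'u) aotd_state \<Rightarrow> ('n, 'x, 'u) aotd_state" where
  "accuracy_pass P c Hb y s =
    (let s' = s\<lparr>dirn := composed c y\<rparr>;
         q = (\<lambda>i. norm (restrict_stages (core CARD('n) c i) (resid P Hb s')) / norm (resid P Hb s'))
     in if accuracy P c Hb s' then s'
        else s'\<lparr>eps_loc := (\<lambda>i. eps_loc s i * exp (- rho_e c * (q i + 1 / sqrt (real (parts c))))),
                ovl := (\<lambda>i. ovl s i + max 1 (nat \<lceil>rho_b c * q i\<rceil>))\<rparr>)"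

definition penalty_update ::
  "('x::finite, 'u::finite) ocp \<Rightarrow> aotd_params \<Rightarrow> ('x, 'u) hblocks \<Rightarrow>
     ('n::finite, 'x, 'u) aotd_state \<Rightarrow> ('n, 'x, 'u) aotd_state" where
  "penalty_update P c Hb s =
    (let s' = s\<lparr>eta1 := (nu c)\<^sup>2 * eta1 s, eta2 := eta2 s / nu c\<rparr>
     in s'\<lparr>eps := min (eps_max P c Hb s') (eps s / nu c ^ 4)\<rparr>)"

text \<open>
  The state after \<open>j\<close> inner iterations of an outer iteration begun with state \<open>s\<close>, where \<open>y j i\<close> is the vector
  returned by the local solver \<open>i\<close> if inner iteration \<open>j\<close> performs local solves. The two nested loops are
  flattened: as long as the accuracy test fails, passes of the accuracy loop are made; when it holds but the
  descent test fails, the penalty parameters are updated; when both hold the state no longer changes.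
\<close>

primrec inner_state ::
  "('x::finite, 'u::finite) ocp \<Rightarrow> aotd_params \<Rightarrow> ('x, 'u) hblocks \<Rightarrow> (nat \<Rightarrow> nat \<Rightarrow> ('n::finite, 'x, 'u) pd) \<Rightarrow>
     ('n, 'x, 'u) aotd_state \<Rightarrow> nat \<Rightarrow> ('n, 'x, 'u) aotd_state" where
  "inner_state P c Hb y s 0 = begin_iteration P c Hb s"
| "inner_state P c Hb y s (Suc j) =
    (let t = inner_state P c Hb y s j
     in if \<not> accuracy P c Hb t then accuracy_pass P c Hb (y j) t
        else if \<not> descent P t then penalty_update P c Hb t
        else t)"

definition armijo ::
  "('x::finite, 'u::finite) ocp \<Rightarrow> aotd_params \<Rightarrow> ('n::finite, 'x, 'u) aotd_state \<Rightarrow> real \<Rightarrow> bool" where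
  "armijo P c s \<alpha> \<longleftrightarrow>
     merit P (eta1 s) (eta2 s) (iterate s + \<alpha> *\<^sub>R dirn s)
       \<le> merit P (eta1 s) (eta2 s) (iterate s)
          + \<alpha> * beta c * (grad (merit P (eta1 s) (eta2 s)) (iterate s) \<bullet> dirn s)"

text \<open>
  \<open>accepted \<dots> s t\<close>: the outer iteration begun with \<open>s\<close> does not return, and its inner loops end in state \<open>t\<close>, whose
  direction is accepted.

  \<open>reaches \<dots> \<tau> s\<close>: the algorithm reaches outer iteration \<open>\<tau>\<close>, which it begins with (iterate and carried-over
  parameters) \<open>s\<close>. The run is determined by the initial state, the modified Hessians \<open>Hm \<tau>\<close> and the outcomes
  \<open>sol \<tau> j i\<close> of the local solves.
\<close>

definition accepted ::
  "('x::finite, 'u::finite) ocp \<Rightarrow> aotd_params \<Rightarrow> ('x, 'u) hblocks \<Rightarrow> (nat \<Rightarrow> nat \<Rightarrow> ('n::finite, 'x, 'u) pd) \<Rightarrow>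
     ('n, 'x, 'u) aotd_state \<Rightarrow> ('n, 'x, 'u) aotd_state \<Rightarrow> bool" where
  "accepted P c Hb y s t \<longleftrightarrow>
     norm (grad_L P (iterate s)) > tol_kkt c \<and>
     (\<exists>j. t = inner_state P c Hb y s j \<and> accuracy P c Hb t \<and> descent P t)"

inductive reaches ::
  "('x::finite, 'u::finite) ocp \<Rightarrow> aotd_params \<Rightarrow> (nat \<Rightarrow> ('x, 'u) hblocks) \<Rightarrow>
     (nat \<Rightarrow> nat \<Rightarrow> nat \<Rightarrow> ('n::finite, 'x, 'u) pd) \<Rightarrow> ('n, 'x, 'u) aotd_state \<Rightarrow>
     nat \<Rightarrow> ('n, 'x, 'u) aotd_state \<Rightarrow> bool"
  for P c Hm sol s0 where
  start: "reaches P c Hm sol s0 0 s0"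
| step: "\<lbrakk>reaches P c Hm sol s0 \<tau> s; accepted P c (Hm \<tau>) (sol \<tau>) s t;
         armijo P c t (delta c ^ m); \<forall>m'<m. \<not> armijo P c t (delta c ^ m')\<rbrakk>
        \<Longrightarrow> reaches P c Hm sol s0 (Suc \<tau>) (t\<lparr>iterate := iterate t + delta c ^ m *\<^sub>R dirn t\<rparr>)"

text \<open>Every local solve that is performed meets its residual condition.\<close>

definition local_solves_ok ::
  "('x::finite, 'u::finite) ocp \<Rightarrow> aotd_params \<Rightarrow> (nat \<Rightarrow> ('x, 'u) hblocks) \<Rightarrow>
     (nat \<Rightarrow> nat \<Rightarrow> nat \<Rightarrow> ('n::finite, 'x, 'u) pd) \<Rightarrow> ('n, 'x, 'u) aotd_state \<Rightarrow> bool" where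
  "local_solves_ok P c Hm sol s0 \<longleftrightarrow>
    (\<forall>\<tau> s j i. reaches P c Hm sol s0 \<tau> s \<longrightarrow> norm (grad_L P (iterate s)) > tol_kkt c \<longrightarrow> i < parts c \<longrightarrow>
       (let t = inner_state P c (Hm \<tau>) (sol \<tau>) s j
        in \<not> accuracy P c (Hm \<tau>) t \<longrightarrow>
           local_solution P c (Hm \<tau>) (iterate t) i (ovl t i) (eps_loc t i) (sol \<tau> j i)))"


section \<open>Assumptions on the run\<close>

definition hessian_modification ::
  "('x::finite, 'u::finite) ocp \<Rightarrow> aotd_params \<Rightarrow> (nat \<Rightarrow> ('x, 'u) hblocks) \<Rightarrow>
     (nat \<Rightarrow> nat \<Rightarrow> nat \<Rightarrow> ('n::finite, 'x, 'u) pd) \<Rightarrow> ('n, 'x, 'u) aotd_state \<Rightarrow> bool" where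
  "hessian_modification P c Hm sol s0 \<longleftrightarrow>
    (\<forall>\<tau> s. reaches P c Hm sol s0 \<tau> s \<longrightarrow>
       (\<forall>k<CARD('n). symmetric_map (fst (Hm \<tau>) k)) \<and> symmetric_map (snd (Hm \<tau>)) \<and>
       (reduced_hessian_ge (jac_f P (fst (iterate s))) (hess_z P (iterate s)) (gam_RH c) \<longrightarrow>
          block_diag (Hm \<tau>) = hess_z P (iterate s)))"

definition reduced_hessian_assm ::
  "('x::finite, 'u::finite) ocp \<Rightarrow> aotd_params \<Rightarrow> (nat \<Rightarrow> ('x, 'u) hblocks) \<Rightarrow>
     (nat \<Rightarrow> nat \<Rightarrow> nat \<Rightarrow> ('n::finite, 'x, 'u) pd) \<Rightarrow> ('n, 'x, 'u) aotd_state \<Rightarrow> bool" where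
  "reduced_hessian_assm P c Hm sol s0 \<longleftrightarrow>
    (\<forall>\<tau> s. reaches P c Hm sol s0 \<tau> s \<longrightarrow>
       reduced_hessian_ge (jac_f P (fst (iterate s))) (block_diag (Hm \<tau>)) (gam_RH c))"

definition controllability_assm ::
  "('x::finite, 'u::finite) ocp \<Rightarrow> aotd_params \<Rightarrow> (nat \<Rightarrow> ('x, 'u) hblocks) \<Rightarrow>
     (nat \<Rightarrow> nat \<Rightarrow> nat \<Rightarrow> ('n::finite, 'x, 'u) pd) \<Rightarrow> ('n, 'x, 'u) aotd_state \<Rightarrow> real \<Rightarrow> nat \<Rightarrow> bool" where
  "controllability_assm P c Hm sol s0 \<gamma>C tC \<longleftrightarrow>
     \<gamma>C \<in> {0<..1} \<and> tC \<in> {1..CARD('n)} \<and>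
     (\<forall>\<tau> s k. reaches P c Hm sol s0 \<tau> s \<longrightarrow> k \<le> CARD('n) - tC \<longrightarrow>
        (\<exists>t\<in>{1..tC}. \<forall>v. \<gamma>C * (v \<bullet> v) \<le> v \<bullet> ctrl_gram P (fst (iterate s)) k t v))"

definition boundedness_assm ::
  "('x::finite, 'u::finite) ocp \<Rightarrow> aotd_params \<Rightarrow> (nat \<Rightarrow> ('x, 'u) hblocks) \<Rightarrow>
     (nat \<Rightarrow> nat \<Rightarrow> nat \<Rightarrow> ('n::finite, 'x, 'u) pd) \<Rightarrow> ('n, 'x, 'u) aotd_state \<Rightarrow> real \<Rightarrow> bool" where
  "boundedness_assm P c Hm sol s0 \<Upsilon> \<longleftrightarrow>
     \<Upsilon> \<ge> 2 \<and>
     (\<forall>\<tau> s. reaches P c Hm sol s0 \<tau> s \<longrightarrow>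
        (\<forall>k<CARD('n). onorm (fst (Hm \<tau>) k) \<le> \<Upsilon> \<and>
             onorm (jac_A P k (zc k (fst (iterate s)))) \<le> \<Upsilon> \<and>
             onorm (jac_B P k (zc k (fst (iterate s)))) \<le> \<Upsilon>) \<and>
        onorm (snd (Hm \<tau>)) \<le> \<Upsilon>)"

text \<open>
  \<open>Zs k\<close> and \<open>ZN\<close> are the factors of the compact set of primal variables, \<open>Ls k\<close> those of the set of multipliers;
  \<open>in_box\<close> is membership in the product. The Hessian blocks are evaluated at points whose other components are
  arbitrary, as they do not depend on them.
\<close>

definition in_box ::
  "(nat \<Rightarrow> ('x::finite, 'u::finite) xu set) \<Rightarrow> (real ^ 'x) set \<Rightarrow> (nat \<Rightarrow> (real ^ 'x) set) \<Rightarrow>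
     ('n::finite, 'x, 'u) pd \<Rightarrow> bool" where
  "in_box Zs ZN Ls w \<longleftrightarrow>
     (\<forall>k<CARD('n). zc k (fst w) \<in> Zs k) \<and> xc CARD('n) (fst w) \<in> ZN \<and> (\<forall>k\<le>CARD('n). lc k (snd w) \<in> Ls k)"

definition smooth_compact_assm ::
  "('x::finite, 'u::finite) ocp \<Rightarrow> aotd_params \<Rightarrow> (nat \<Rightarrow> ('x, 'u) hblocks) \<Rightarrow>
     (nat \<Rightarrow> nat \<Rightarrow> nat \<Rightarrow> ('n::finite, 'x, 'u) pd) \<Rightarrow> ('n, 'x, 'u) aotd_state \<Rightarrow> real \<Rightarrow> bool" where
  "smooth_compact_assm P c Hm sol s0 \<Upsilon> \<longleftrightarrow>
     (\<forall>k<CARD('n). Ck 3 (cost P k) \<and> Ck 3 (dyn P k)) \<and> Ck 3 (costN P) \<and>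
     (\<exists>Zs ZN Ls.
        (\<forall>k<CARD('n). compact (Zs k)) \<and> compact ZN \<and> (\<forall>k\<le>CARD('n). compact (Ls k)) \<and>
        (\<forall>\<tau> s. reaches P c Hm sol s0 \<tau> s \<longrightarrow> in_box Zs ZN Ls (iterate s)) \<and>
        (\<forall>\<tau> s t \<alpha>. reaches P c Hm sol s0 \<tau> s \<longrightarrow> accepted P c (Hm \<tau>) (sol \<tau>) s t \<longrightarrow> \<alpha> \<in> {0..1} \<longrightarrow>
           in_box Zs ZN Ls (iterate t + \<alpha> *\<^sub>R dirn t)) \<and>
        (\<forall>k<CARD('n). \<forall>w :: ('n, 'x, 'u) pd. zc k (fst w) \<in> Zs k \<longrightarrow> lc (k + 1) (snd w) \<in> Ls (k + 1) \<longrightarrow>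
           onorm (diag_block k (hess_z P w)) \<le> \<Upsilon>) \<and>
        (\<forall>k<CARD('n). \<forall>y\<in>Zs k. onorm (jac_A P k y) \<le> \<Upsilon> \<and> onorm (jac_B P k y) \<le> \<Upsilon>) \<and>
        (\<forall>w :: ('n, 'x, 'u) pd. xc CARD('n) (fst w) \<in> ZN \<longrightarrow> onorm (diag_blockN (hess_z P w)) \<le> \<Upsilon>))"

end

theory Submission
  imports Defs
begin

text \<open>
  Each failing pass of the accuracy loop enlarges every overlap by at least one and shrinks every local tolerance
  by at least the factor \<open>exp (- \<rho>\<^sub>\<epsilon> / \<surd>M)\<close>. After at most \<open>N\<close> passes every window is \<open>[0, N]\<close>,
  where no terminal penalty occurs and the local KKT system is the global one. Its matrix is
  nonsingular, so all local solutions, and with them the composed direction, tend to the Newton direction \<open>d\<close>, and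
  the accuracy test, whose threshold is a positive constant meanwhile, succeeds.

  After \<open>m\<close> penalty updates, with \<open>t = \<nu>\<^sup>-\<^sup>m\<close>, the penalties are \<open>h\<^sub>1 / t\<^sup>2\<close> and \<open>h\<^sub>2 t\<close>, and an accurate
  direction differs from \<open>d\<close> by \<open>O(t\<^sup>4)\<close>, which changes the slope of the merit function by \<open>O(t\<^sup>2)\<close>. The iterate
  being fixed, it suffices to consider the exact slope as \<open>t \<rightarrow> 0\<close>. Write \<open>(a, b)\<close> for the gradient of the
  Lagrangian. If \<open>b \<noteq> 0\<close>, the slope is \<open>- h\<^sub>1 |b|\<^sup>2 / t\<^sup>2 + O(1)\<close>. If \<open>b = 0\<close>, the primal part of \<open>d\<close> lies in
  the kernel of the constraint Jacobian; if it is nonzero, the slope tends to minus the reduced Hessian form, which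
  is negative, and if it vanishes, the slope is exactly \<open>- h\<^sub>2 t |a|\<^sup>2\<close>.
\<close>

section \<open>Stages\<close>

lemma stage_stage_no [simp]: "stage (stage_no a) = (a :: 'i::finite)"
  by (simp add: stage_def stage_no_def)

lemma bij_stage_no: "bij_betw stage_no (UNIV :: 'i::finite set) {..<CARD('i)}"
  unfolding stage_no_def[abs_def] by (rule to_nat_on_finite) simp

lemma stage_no_less [simp]: "stage_no (a :: 'i::finite) < CARD('i)"
  using bij_stage_no[where 'i='i] by (auto simp: bij_betw_def)

lemma stage_no_le [simp]: "stage_no (a :: 'n::finite option) \<le> CARD('n)"
  using stage_no_less[of a] by simp

lemma stage_no_stage [simp]:
  assumes "k < CARD('i)"
  shows "stage_no (stage k :: 'i::finite) = k"
proof -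
  have "k \<in> stage_no ` (UNIV :: 'i set)"
    using assms bij_stage_no[where 'i='i] by (auto simp: bij_betw_def)
  then show ?thesis by auto
qed

lemma stage_inj: "k < CARD('i) \<Longrightarrow> j < CARD('i) \<Longrightarrow> (stage k :: 'i::finite) = stage j \<longleftrightarrow> k = j"
  by (metis stage_no_stage)

lemma sum_over_stages: "(\<Sum>a\<in>(UNIV :: 'i::finite set). f a) = (\<Sum>k<CARD('i). f (stage k))"
proof -
  have "(\<Sum>k<CARD('i). f (stage k)) = (\<Sum>a\<in>(UNIV :: 'i set). f (stage (stage_no a)))"
    by (rule sum.reindex_bij_betw[OF bij_stage_no, symmetric])
  then show ?thesis by simp
qed

lemma bounded_linear_xc: "bounded_linear (xc k)"
  unfolding xc_def[abs_def] by (intro bounded_linear_compose[OF bounded_linear_vec_nth bounded_linear_fst])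

lemma bounded_linear_uc: "bounded_linear (uc k)"
  unfolding uc_def[abs_def] by (intro bounded_linear_compose[OF bounded_linear_vec_nth bounded_linear_snd])

lemma bounded_linear_zc: "bounded_linear (zc k)"
  unfolding zc_def[abs_def] by (intro bounded_linear_Pair bounded_linear_xc bounded_linear_uc)

lemmas xc_linear = bounded_linear.linear[OF bounded_linear_xc]
lemmas zc_linear = bounded_linear.linear[OF bounded_linear_zc]

lemma inner_primal:
  fixes z \<omega> :: "('n::finite, 'x::finite, 'u::finite) primal"
  shows "z \<bullet> \<omega> = (\<Sum>k<CARD('n). xc k z \<bullet> xc k \<omega> + uc k z \<bullet> uc k \<omega>) + xc CARD('n) z \<bullet> xc CARD('n) \<omega>"
  by (simp add: inner_prod_def inner_vec_def sum_over_stages xc_def uc_def sum.distrib)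

text \<open>Stage 0 is split off because its multiplier belongs to the initial condition, while the
  multiplier of stage \<open>Suc k\<close> belongs to the dynamics of stage
  \<open>k\<close>.\<close>

lemma inner_dual:
  fixes l m :: "('n::finite, 'x::finite) dual"
  shows "l \<bullet> m = lc 0 l \<bullet> lc 0 m + (\<Sum>k<CARD('n). lc (Suc k) l \<bullet> lc (Suc k) m)"
  by (simp add: inner_vec_def sum_over_stages lc_def sum.lessThan_Suc_shift del: sum.lessThan_Suc)

section \<open>Derivatives\<close>

text \<open>The basis vectors of a vector of vectors have the form \<open>axis i u\<close>, so an
  inner product with one of them sees a single block only.\<close>

lemma has_derivative_vecI:
  fixes f :: "'a::real_normed_vector \<Rightarrow> 'b::euclidean_space ^ 'i"
  assumes "\<And>i. ((\<lambda>x. f x $ i) has_derivative (\<lambda>h. f' h $ i)) (at x)"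
  shows "(f has_derivative f') (at x)"
proof (subst has_derivative_componentwise_within, intro ballI)
  fix e :: "'b ^ 'i" assume "e \<in> Basis"
  then obtain i u where e: "e = axis i u" by (auto simp: Basis_vec_def)
  show "((\<lambda>x. f x \<bullet> e) has_derivative (\<lambda>x. f' x \<bullet> e)) (at x)"
    unfolding e inner_axis by (intro derivative_intros assms)
qed

lemma differentiable_vecI:
  fixes f :: "'a::real_normed_vector \<Rightarrow> 'b::euclidean_space ^ 'i"
  assumes "\<And>i. (\<lambda>x. f x $ i) differentiable (at x)"
  shows "f differentiable (at x)"
proof -
  from assms obtain f' where "\<And>i. ((\<lambda>x. f x $ i) has_derivative f' i) (at x)"
    unfolding differentiable_def by metis
  then have "(f has_derivative (\<lambda>h. \<chi> i. f' i h)) (at x)"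
    by (intro has_derivative_vecI) simp
  then show ?thesis by (rule differentiableI)
qed

lemma grad_eqI:
  assumes "(F has_derivative (\<lambda>h. h \<bullet> D)) (at a)"
  shows "grad F a = D"
  unfolding grad_def gderiv_def
proof (rule the_equality)
  fix E assume "(F has_derivative (\<lambda>h. h \<bullet> E)) (at a)"
  then have "(\<lambda>h. h \<bullet> E) = (\<lambda>h. h \<bullet> D)" using assms by (rule has_derivative_unique)
  then have "(E - D) \<bullet> (E - D) = 0" by (auto simp: inner_diff_right dest: fun_cong[where x="E - D"])
  then show "E = D" by simp
qed (fact assms)

text \<open>The Riesz representative of the derivative is \<open>adjoint F' 1\<close>. Hence
  differentiability alone makes the definite description in \<open>grad\<close> meaningful.\<close>

lemma inner_grad:
  fixes F :: "'a::euclidean_space \<Rightarrow> real"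
  assumes F: "(F has_derivative F') (at a)"
  shows "h \<bullet> grad F a = F' h"
proof -
  have lin: "linear F'" using F by (rule has_derivative_linear)
  have "(\<lambda>h. h \<bullet> adjoint F' 1) = F'" using adjoint_works[OF lin, of _ 1] by auto
  with F have "(F has_derivative (\<lambda>h. h \<bullet> adjoint F' 1)) (at a)" by simp
  then show ?thesis using adjoint_works[OF lin, of h 1] by (simp add: grad_eqI)
qed

text \<open>Reduces the gradient and Hessian of a local quadratic program to its second-order
  expansion. Symmetry of \<open>T\<close> merges the two terms that the product rule yields.\<close>

lemma quadratic_grad_hess:
  fixes T :: "'a::euclidean_space \<Rightarrow> 'a"
  assumes T: "linear T" and sym: "\<And>v w. v \<bullet> T w = T v \<bullet> w"
    and Q: "\<And>v. Q v = q + g \<bullet> v + 1/2 * (v \<bullet> T v)"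
  shows "grad Q v = T v + g" "hess Q a = T"
proof -
  have bl: "bounded_linear T" using T by (simp add: linear_conv_bounded_linear)
  have gr: "grad Q v = T v + g" for v
  proof (rule grad_eqI)
    have Q': "Q = (\<lambda>v. q + g \<bullet> v + 1/2 * (v \<bullet> T v))" by (rule ext) (rule Q)
    have "(Q has_derivative (\<lambda>h. 0 + g \<bullet> h + 1/2 * (v \<bullet> T h + h \<bullet> T v))) (at v)"
      unfolding Q'
      by (intro has_derivative_add has_derivative_const has_derivative_mult_right has_derivative_inner_right
          has_derivative_inner has_derivative_ident bounded_linear_imp_has_derivative[OF bl])
    also have "(\<lambda>h. 0 + g \<bullet> h + 1/2 * (v \<bullet> T h + h \<bullet> T v)) = (\<lambda>h. h \<bullet> (T v + g))"
      by (rule ext) (use sym[of v] in \<open>simp add: inner_add_right inner_commute\<close>)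
    finally show "(Q has_derivative (\<lambda>h. h \<bullet> (T v + g))) (at v)" .
  qed
  then show "grad Q v = T v + g" .
  have "(grad Q has_derivative T) (at a)"
    using has_derivative_add[OF bounded_linear_imp_has_derivative[OF bl] has_derivative_const[of g]] by (simp add: gr[abs_def])
  then show "hess Q a = T" unfolding hess_def by (rule frechet_derivative_at[symmetric])
qed

section \<open>Derivatives of the problem data and of the constraint map\<close>

lemma Ck_differentiable: "Ck 3 F \<Longrightarrow> F differentiable (at x)"
  by (simp add: numeral_3_eq_3)

lemma Ck_differentiable2: "Ck 3 F \<Longrightarrow> (\<lambda>x. frechet_derivative F (at x) v) differentiable (at x)"
  by (simp add: numeral_3_eq_3)

text \<open>The differentiability clause of \<open>smooth_compact_assm\<close>. The horizon is an
  argument because the type of \<open>P\<close> does not determine it.\<close>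

definition smooth_ocp :: "('x::finite, 'u::finite) ocp \<Rightarrow> nat \<Rightarrow> bool" where
  "smooth_ocp P n \<longleftrightarrow> (\<forall>k<n. Ck 3 (cost P k) \<and> Ck 3 (dyn P k)) \<and> Ck 3 (costN P)"

text \<open>The partial Jacobians are the total derivative restricted to \<open>(h, 0)\<close> and
  \<open>(0, h)\<close>, and linearity puts the total derivative together again.\<close>

lemma dyn_jacobians:
  assumes "Ck 3 (dyn P k)"
  shows linear_jac_B: "linear (jac_B P k y)"
    and has_derivative_dyn: "(dyn P k has_derivative (\<lambda>h. jac_A P k y (fst h) + jac_B P k y (snd h))) (at y)"
proof -
  define D where "D = frechet_derivative (dyn P k) (at y)"
  have D: "(dyn P k has_derivative D) (at y)"
    unfolding D_def using Ck_differentiable[OF assms] frechet_derivative_works by blast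
  then have D': "(dyn P k has_derivative D) (at (fst y, snd y))" by simp
  have "((\<lambda>x. dyn P k (x, snd y)) has_derivative (\<lambda>h. D (h, 0))) (at (fst y))"
    by (rule has_derivative_compose[where f="\<lambda>x. (x, snd y)", OF _ D']) (auto intro!: derivative_eq_intros)
  then have A: "jac_A P k y = (\<lambda>h. D (h, 0))"
    unfolding jac_A_def by (rule frechet_derivative_at[symmetric])
  have "((\<lambda>u. dyn P k (fst y, u)) has_derivative (\<lambda>h. D (0, h))) (at (snd y))" (is ?B)
    by (rule has_derivative_compose[where f="\<lambda>u. (fst y, u)", OF _ D']) (auto intro!: derivative_eq_intros)
  then have B: "jac_B P k y = (\<lambda>h. D (0, h))"
    unfolding jac_B_def by (rule frechet_derivative_at[symmetric])
  have "(\<lambda>h. D (fst h, 0) + D (0, snd h)) = D"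
    using linear_add[OF has_derivative_linear[OF D], of "(x, 0)" "(0, y)" for x y, symmetric] by auto
  then show "(dyn P k has_derivative (\<lambda>h. jac_A P k y (fst h) + jac_B P k y (snd h))) (at y)"
    using D unfolding A B by simp
  show "linear (jac_B P k y)" unfolding B using \<open>?B\<close> by (rule has_derivative_linear)
qed

lemma has_derivative_constr:
  fixes P :: "('x::finite, 'u::finite) ocp" and z :: "('n::finite, 'x, 'u) primal"
  assumes P: "smooth_ocp P CARD('n)"
  shows "(constr P has_derivative
     (\<lambda>\<omega>. \<chi> a. case stage_no a of 0 \<Rightarrow> xc 0 \<omega>
        | Suc k \<Rightarrow> xc (Suc k) \<omega> - (jac_A P k (zc k z) (xc k \<omega>) + jac_B P k (zc k z) (uc k \<omega>)))) (at z)"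
proof (rule has_derivative_vecI)
  fix a :: "'n option"
  show "((\<lambda>x. constr P x $ a) has_derivative
     (\<lambda>h. (\<chi> a. case stage_no a of 0 \<Rightarrow> xc 0 h
        | Suc k \<Rightarrow> xc (Suc k) h - (jac_A P k (zc k z) (xc k h) + jac_B P k (zc k z) (uc k h))) $ a)) (at z)"
  proof (cases "stage_no a")
    case 0
    have "((\<lambda>x. xc 0 x - x0bar P) has_derivative (\<lambda>h. xc 0 h)) (at z)"
      by (rule derivative_eq_intros bounded_linear_imp_has_derivative[OF bounded_linear_xc] refl)+ simp
    then show ?thesis by (simp add: constr_def 0)
  next
    case (Suc k)
    then have "k < CARD('n)" using stage_no_less[of a] by simp
    then have C: "Ck 3 (dyn P k)" using P by (simp add: smooth_ocp_def)
    have "((\<lambda>z. dyn P k (zc k z)) has_derivative (\<lambda>h. jac_A P k (zc k z) (fst (zc k h)) + jac_B P k (zc k z) (snd (zc k h)))) (at z)"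
      by (rule has_derivative_compose[OF bounded_linear_imp_has_derivative[OF bounded_linear_zc] has_derivative_dyn[OF C]])
    then have "((\<lambda>z. dyn P k (zc k z)) has_derivative (\<lambda>h. jac_A P k (zc k z) (xc k h) + jac_B P k (zc k z) (uc k h))) (at z)"
      by (simp add: zc_def)
    then show ?thesis
      by (simp add: constr_def Suc) (intro derivative_intros bounded_linear_imp_has_derivative[OF bounded_linear_xc])
  qed
qed

lemma jac_f:
  fixes P :: "('x::finite, 'u::finite) ocp" and z :: "('n::finite, 'x, 'u) primal"
  assumes P: "smooth_ocp P CARD('n)"
  shows has_derivative_jac_f: "(constr P has_derivative jac_f P z) (at z)"
    and linear_jac_f: "linear (jac_f P z)"
    and jac_f_stage: "jac_f P z \<omega> $ a = (case stage_no a of 0 \<Rightarrow> xc 0 \<omega>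
        | Suc k \<Rightarrow> xc (Suc k) \<omega> - (jac_A P k (zc k z) (xc k \<omega>) + jac_B P k (zc k z) (uc k \<omega>)))"
proof -
  note D = has_derivative_constr[OF P, of z]
  note E = frechet_derivative_at[OF D]
  show D': "(constr P has_derivative jac_f P z) (at z)"
    unfolding jac_f_def E[symmetric] by (rule D)
  show "linear (jac_f P z)" using D' by (rule has_derivative_linear)
  show "jac_f P z \<omega> $ a = (case stage_no a of 0 \<Rightarrow> xc 0 \<omega>
        | Suc k \<Rightarrow> xc (Suc k) \<omega> - (jac_A P k (zc k z) (xc k \<omega>) + jac_B P k (zc k z) (uc k \<omega>)))"
    unfolding jac_f_def E[symmetric] by simp
qed

section \<open>The quadratic program on the full window\<close>

text \<open>The Lagrangian is affine in the multipliers, with the constraint value as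
  coefficient.\<close>

lemma grad_l_eq: "grad_l P w = constr P (fst w)"
  unfolding grad_l_def lagr_def by (rule grad_eqI) (auto intro!: derivative_eq_intros)

lemma lc_constr_0 [simp]: "lc 0 (constr P z) = xc 0 z - x0bar P"
  by (simp add: lc_def constr_def)

lemma symmetric_map_inner: "symmetric_map T \<Longrightarrow> v \<bullet> T w = T v \<bullet> w"
  unfolding symmetric_map_def by (metis adjoint_works)

lemma linear_block_diag:
  fixes Hb :: "('x::finite, 'u::finite) hblocks"
  assumes "\<forall>k<CARD('n). linear (fst Hb k)" "linear (snd Hb)"
  shows "linear (block_diag Hb :: ('n::finite, 'x, 'u) primal \<Rightarrow> _)"
  by (rule linearI)
    (use assms in \<open>simp_all add: block_diag_def vec_eq_iff linear_add linear_scale zc_linear xc_linear prod_eq_iff\<close>)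

lemma inner_block_diag:
  fixes z \<omega> :: "('n::finite, 'x::finite, 'u::finite) primal"
  shows "z \<bullet> block_diag Hb \<omega>
    = (\<Sum>k<CARD('n). zc k z \<bullet> fst Hb k (zc k \<omega>)) + xc CARD('n) z \<bullet> snd Hb (xc CARD('n) \<omega>)"
proof -
  have "xc k z \<bullet> xc k (block_diag Hb \<omega>) + uc k z \<bullet> uc k (block_diag Hb \<omega>) = zc k z \<bullet> fst Hb k (zc k \<omega>)"
    if "k < CARD('n)" for k
    using that by (simp add: xc_def uc_def block_diag_def zc_def inner_prod_def)
  then show ?thesis
    by (simp add: inner_primal) (simp add: xc_def block_diag_def)
qed

lemma block_diag_symmetric:
  fixes z \<omega> :: "('n::finite, 'x::finite, 'u::finite) primal"
  assumes "\<forall>k<CARD('n). symmetric_map (fst Hb k)" "symmetric_map (snd Hb)"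
  shows "z \<bullet> block_diag Hb \<omega> = block_diag Hb z \<bullet> \<omega>"
proof -
  have "\<omega> \<bullet> block_diag Hb z = z \<bullet> block_diag Hb \<omega>"
    unfolding inner_block_diag
  proof (intro arg_cong2[where f="(+)"] sum.cong refl)
    fix k assume "k \<in> {..<CARD('n)}"
    then have "symmetric_map (fst Hb k)" using assms(1) by simp
    then show "zc k \<omega> \<bullet> fst Hb k (zc k z) = zc k z \<bullet> fst Hb k (zc k \<omega>)"
      by (metis symmetric_map_inner inner_commute)
  qed (metis assms(2) symmetric_map_inner inner_commute)
  then show ?thesis by (simp add: inner_commute)
qed

lemma linear_kkt_map: "linear H \<Longrightarrow> linear G \<Longrightarrow> linear (kkt_map H G)"
  unfolding kkt_map_def
  by (rule linearI) (simp_all add: linear_add linear_scale adjoint_linear algebra_simps)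

text \<open>Moving the adjoint to the other side leaves an expression in \<open>G\<close> alone,
  which shows both the symmetry of the KKT operator and the value of its quadratic form.\<close>

lemma inner_kkt_map:
  assumes "linear G"
  shows "v \<bullet> kkt_map H G w = fst v \<bullet> H (fst w) + G (fst v) \<bullet> snd w + snd v \<bullet> G (fst w)"
  using assms by (simp add: kkt_map_def inner_prod_def inner_add_right adjoint_works)

lemma inner_jac_f:
  fixes P :: "('x::finite, 'u::finite) ocp" and z :: "('n::finite, 'x, 'u) primal"
  assumes P: "smooth_ocp P CARD('n)"
  shows "l \<bullet> jac_f P z \<omega> = lc 0 l \<bullet> xc 0 \<omega>
    + (\<Sum>k<CARD('n). lc (Suc k) l \<bullet> (xc (Suc k) \<omega> - (jac_A P k (zc k z) (xc k \<omega>) + jac_B P k (zc k z) (uc k \<omega>))))"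
proof -
  have "lc 0 (jac_f P z \<omega>) = xc 0 \<omega>"
    using jac_f_stage[OF P, of z \<omega> "stage 0"] by (simp add: lc_def)
  moreover have "lc (Suc k) (jac_f P z \<omega>) = xc (Suc k) \<omega> - (jac_A P k (zc k z) (xc k \<omega>) + jac_B P k (zc k z) (uc k \<omega>))"
    if "k < CARD('n)" for k
    using that jac_f_stage[OF P, of z \<omega> "stage (Suc k)"] by (simp add: lc_def)
  ultimately show ?thesis by (simp add: inner_dual)
qed

text \<open>On the window \<open>[0, N]\<close> the terminal block is the unpenalised one, and the
  objective and constraints of the quadratic program run over all stages. Its Lagrangian is
  therefore the global quadratic model, whatever \<open>m\<close> is.\<close>

lemma qp_lagr_full_window:
  fixes P :: "('x::finite, 'u::finite) ocp" and w v :: "('n::finite, 'x, 'u) pd"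
  assumes P: "smooth_ocp P CARD('n)"
  shows "qp_lagr P m Hb w 0 CARD('n) v = grad_L P w \<bullet> v + 1/2 * (v \<bullet> Gam P Hb w v)"
proof -
  define \<omega> \<zeta> gz gl z where defs: "\<omega> = fst v" "\<zeta> = snd v" "gz = grad_z P w" "gl = grad_l P w" "z = fst w"
  let ?G = "jac_f P z"
  \<comment> \<open>The initial value prescribed for the quadratic program is minus the stage-0
    constraint residual, so the initial condition fits the pattern of the linearised
    constraints.\<close>
  have gl0: "lc 0 gl = xc 0 z - x0bar P" by (simp add: defs grad_l_eq)
  have q: "v \<bullet> Gam P Hb w v = \<omega> \<bullet> block_diag Hb \<omega> + 2 * (\<zeta> \<bullet> ?G \<omega>)"
    unfolding Gam_def inner_kkt_map[OF linear_jac_f[OF P]] by (simp add: defs inner_commute)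
  have l: "grad_L P w \<bullet> v = gz \<bullet> \<omega> + gl \<bullet> \<zeta>"
    by (simp add: grad_L_def inner_prod_def defs)
  have "qp_lagr P m Hb w 0 CARD('n) v =
     (\<Sum>k<CARD('n). 1/2 * (zc k \<omega> \<bullet> fst Hb k (zc k \<omega>)) + (xc k gz \<bullet> xc k \<omega> + uc k gz \<bullet> uc k \<omega>))
        + 1/2 * (xc CARD('n) \<omega> \<bullet> snd Hb (xc CARD('n) \<omega>)) + xc CARD('n) gz \<bullet> xc CARD('n) \<omega>
        + lc 0 \<zeta> \<bullet> (xc 0 \<omega> + lc 0 gl)
        + (\<Sum>k<CARD('n). lc (Suc k) \<zeta> \<bullet>
             (xc (Suc k) \<omega> - (jac_A P k (zc k z) (xc k \<omega>) + jac_B P k (zc k z) (uc k \<omega>))) + lc (Suc k) \<zeta> \<bullet> lc (Suc k) gl)"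
    unfolding qp_lagr_def Let_def gl0
    by (simp add: defs atLeast0LessThan add.assoc diff_diff_eq inner_add_right[symmetric] diff_diff_eq2 add_diff_eq)
  also have "\<dots> = 1/2 * (\<omega> \<bullet> block_diag Hb \<omega>) + gz \<bullet> \<omega> + \<zeta> \<bullet> ?G \<omega> + gl \<bullet> \<zeta>"
    unfolding inner_block_diag inner_primal[of gz] inner_jac_f[OF P] inner_commute[of gl] inner_dual[of \<zeta> gl]
    by (simp add: sum.distrib sum_subtractf sum_distrib_left inner_add_right algebra_simps)
  finally show ?thesis unfolding q l by simp
qed

lemma linear_Gam:
  fixes P :: "('x::finite, 'u::finite) ocp" and w :: "('n::finite, 'x, 'u) pd"
  assumes "smooth_ocp P CARD('n)"
    and "\<forall>k<CARD('n). symmetric_map (fst Hb k)" "symmetric_map (snd Hb)"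
  shows "linear (Gam P Hb w)"
  unfolding Gam_def
  by (intro linear_kkt_map linear_block_diag linear_jac_f) (use assms in \<open>simp_all add: symmetric_map_def\<close>)

lemma qp_full_window:
  fixes P :: "('x::finite, 'u::finite) ocp" and w :: "('n::finite, 'x, 'u) pd"
  assumes P: "smooth_ocp P CARD('n)"
    and H: "\<forall>k<CARD('n). symmetric_map (fst Hb k)" "symmetric_map (snd Hb)"
  shows "grad (qp_lagr P m Hb w 0 CARD('n)) 0 = grad_L P w"
    and "hess (qp_lagr P m Hb w 0 CARD('n)) 0 = Gam P Hb w"
proof -
  have sym: "v \<bullet> Gam P Hb w v' = Gam P Hb w v \<bullet> v'" for v v'
    unfolding inner_commute[of "Gam P Hb w v"] unfolding Gam_def inner_kkt_map[OF linear_jac_f[OF P]]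
    using block_diag_symmetric[OF H, of "fst v" "fst v'"] by (simp add: inner_commute)
  note L = linear_Gam[OF P H, of w]
  note Q = quadratic_grad_hess[OF L sym, where q=0 and g="grad_L P w" and Q="qp_lagr P m Hb w 0 CARD('n)"]
  have "grad (qp_lagr P m Hb w 0 CARD('n)) 0 = Gam P Hb w 0 + grad_L P w"
    by (rule Q(1)) (simp add: qp_lagr_full_window[OF P])
  then show "grad (qp_lagr P m Hb w 0 CARD('n)) 0 = grad_L P w" by (simp add: linear_0[OF L])
  show "hess (qp_lagr P m Hb w 0 CARD('n)) 0 = Gam P Hb w"
    by (rule Q(2)) (simp add: qp_lagr_full_window[OF P])
qed

text \<open>No knot exceeds \<open>N\<close>, so an overlap of at least \<open>N\<close> truncates
  the window to \<open>[0, N]\<close> at both ends for every subproblem.\<close>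

lemma local_solution_full_window:
  fixes P :: "('x::finite, 'u::finite) ocp" and w v :: "('n::finite, 'x, 'u) pd"
  assumes "smooth_ocp P CARD('n)"
    and "\<forall>k<CARD('n). symmetric_map (fst Hb k)" "symmetric_map (snd Hb)"
    and c: "valid_params CARD('n) c" and i: "i < parts c" and b: "CARD('n) \<le> b"
  shows "local_solution P c Hb w i b e v \<longleftrightarrow> norm (Gam P Hb w v + grad_L P w) \<le> e * norm (grad_L P w)"
proof -
  have "knot c i \<le> knot c (parts c)"
    using c i strict_mono_onD[of "{0..parts c}" "knot c" i "parts c"] by (simp add: valid_params_def)
  then have "win_lo c i b = 0" using c b by (simp add: win_lo_def valid_params_def)
  moreover have "win_hi CARD('n) c i b = CARD('n)" using b by (simp add: win_hi_def)
  ultimately show ?thesis by (simp only: local_solution_def Let_def qp_full_window[OF assms(1-3)])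
qed

section \<open>Nonsingularity\<close>

text \<open>In the state variables the Jacobian is block lower triangular with identity blocks on
  the diagonal. Forward substitution with zero controls, the recursion \<open>X\<close>, therefore
  solves for every right-hand side.\<close>

lemma surj_jac_f:
  fixes P :: "('x::finite, 'u::finite) ocp" and z :: "('n::finite, 'x, 'u) primal"
  assumes P: "smooth_ocp P CARD('n)"
  shows "surj (jac_f P z)"
proof -
  have "\<exists>\<omega>. jac_f P z \<omega> = l" for l
  proof -
    define X where "X = rec_nat (lc 0 l) (\<lambda>k x. lc (Suc k) l + jac_A P k (zc k z) x)"
    define \<omega> :: "('n, 'x, 'u) primal" where "\<omega> = ((\<chi> a. X (stage_no a)), 0)"
    have B0: "jac_B P k (zc k z) 0 = 0" if "k < CARD('n)" for k
    proof -
      have "Ck 3 (dyn P k)" using P that by (simp add: smooth_ocp_def)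
      then show ?thesis by (intro linear_0 linear_jac_B)
    qed
    have "jac_f P z \<omega> $ a = l $ a" for a
    proof (cases "stage_no a")
      case 0
      then have "lc 0 l = l $ a" by (metis lc_def stage_stage_no)
      then show ?thesis using 0 by (simp add: jac_f_stage[OF P] \<omega>_def xc_def X_def)
    next
      case (Suc k)
      then have k: "k < CARD('n)" using stage_no_less[of a] by simp
      have "lc (Suc k) l = l $ a" using Suc by (metis lc_def stage_stage_no)
      moreover have "uc k \<omega> = 0" "xc k \<omega> = X k" "xc (Suc k) \<omega> = X (Suc k)"
        using k by (simp_all add: \<omega>_def xc_def uc_def)
      ultimately show ?thesis using Suc B0[OF k] by (simp add: jac_f_stage[OF P] X_def)
    qed
    then show ?thesis by (metis vec_eq_iff)
  qed
  then show ?thesis by (metis surj_def)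
qed

text \<open>A maximiser of the form on the unit sphere is an eigenvector: were the residual
  \<open>y\<close> nonzero, a small move along it would raise the Rayleigh quotient to first
  order.\<close>

lemma symmetric_form_has_eigenvalue:
  fixes S :: "'a::euclidean_space \<Rightarrow> 'a"
  assumes S: "linear S" and sym: "\<And>v w. v \<bullet> S w = S v \<bullet> w"
  obtains v r where "norm v = 1" "S v = r *\<^sub>R v"
proof -
  have "continuous_on (sphere 0 1) (\<lambda>v. v \<bullet> S v)"
    by (intro continuous_intros linear_continuous_on) (use S in \<open>simp add: linear_conv_bounded_linear\<close>)
  then obtain v where v: "v \<in> sphere 0 1" and max: "\<And>x. x \<in> sphere 0 1 \<Longrightarrow> x \<bullet> S x \<le> v \<bullet> S v"
    using continuous_attains_sup[of "sphere (0::'a) 1" "\<lambda>v. v \<bullet> S v"] by auto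
  define r where "r = v \<bullet> S v"
  have le: "x \<bullet> S x \<le> r * (x \<bullet> x)" for x
  proof (cases "x = 0")
    case True then show ?thesis by (simp add: linear_0[OF S])
  next
    case False
    have "(x /\<^sub>R norm x) \<bullet> S (x /\<^sub>R norm x) \<le> r" unfolding r_def by (rule max) (use False in simp)
    then have "(x \<bullet> S x) / (norm x)\<^sup>2 \<le> r" by (simp add: linear_scale[OF S] divide_simps power2_eq_square)
    then show ?thesis using False by (simp add: divide_le_eq power2_norm_eq_inner)
  qed
  define y where "y = S v - r *\<^sub>R v"
  have "v \<bullet> v = 1" using v by (simp add: dot_square_norm)
  have vy: "v \<bullet> y = 0" by (simp add: y_def inner_diff_right \<open>v \<bullet> v = 1\<close>) (simp add: r_def)
  have Svy: "S v \<bullet> y = y \<bullet> y" using vy by (simp add: y_def inner_diff_left)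
  define q where "q = r * (y \<bullet> y) - y \<bullet> S y"
  have "2 * t * (y \<bullet> y) \<le> t\<^sup>2 * q" for t
  proof -
    note le[of "v + t *\<^sub>R y"]
    moreover have "y \<bullet> S v = y \<bullet> y" "v \<bullet> S y = y \<bullet> y" using Svy sym[of v y] by (simp_all add: inner_commute)
    moreover have "v \<bullet> S v = r" "y \<bullet> v = 0" using vy by (simp_all add: r_def inner_commute)
    ultimately have "r + t * (y \<bullet> y) + t * (y \<bullet> y) + t\<^sup>2 * (y \<bullet> S y) \<le> r * (1 + t\<^sup>2 * (y \<bullet> y))"
      using vy \<open>v \<bullet> v = 1\<close>
      by (simp add: linear_add[OF S] linear_scale[OF S] inner_add_left inner_add_right power2_eq_square algebra_simps)
    then show ?thesis by (simp add: q_def algebra_simps)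
  qed
  \<comment> \<open>This step length makes the first-order gain outweigh the second-order term; the
    denominator is positive whatever the sign of \<open>q\<close>.\<close>
  from this[of "(y \<bullet> y) / (\<bar>q\<bar> + 1)"]
  have "2 * (y \<bullet> y)\<^sup>2 / (\<bar>q\<bar> + 1) \<le> (y \<bullet> y)\<^sup>2 * (q / (\<bar>q\<bar> + 1)\<^sup>2)"
    by (simp add: power2_eq_square)
  also have "\<dots> \<le> (y \<bullet> y)\<^sup>2 * (1 / (\<bar>q\<bar> + 1))"
  proof (rule mult_left_mono)
    have "q / (\<bar>q\<bar> + 1)\<^sup>2 \<le> (\<bar>q\<bar> + 1) / (\<bar>q\<bar> + 1)\<^sup>2" by (intro divide_right_mono) auto
    then show "q / (\<bar>q\<bar> + 1)\<^sup>2 \<le> 1 / (\<bar>q\<bar> + 1)" by (simp add: power2_eq_square)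
  qed simp
  finally have "(y \<bullet> y)\<^sup>2 / (\<bar>q\<bar> + 1) \<le> 0" by simp
  moreover have "\<bar>q\<bar> + 1 > 0" by simp
  ultimately have "y \<bullet> y = 0" by (auto simp: divide_le_0_iff)
  then have "S v = r *\<^sub>R v" by (simp add: y_def)
  then show thesis using that v by auto
qed

text \<open>Injectivity of the adjoint bounds all singular values below by some
  \<open>B > 0\<close>. The bound passes to the infimum once the set is known to be nonempty, which
  an eigenvector of \<open>G \<circ> adjoint G\<close> provides.\<close>

lemma sigma_min_pos:
  fixes G :: "'a::euclidean_space \<Rightarrow> 'b::euclidean_space"
  assumes G: "linear G" "surj G"
  shows "sigma_min G > 0"
proof -
  have la: "linear (adjoint G)" by (rule adjoint_linear[OF G(1)])
  have "inj (adjoint G)" using G by (simp add: linear_surj_adj_imp_inj)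
  then obtain B where B: "B > 0" "\<And>v. B * norm v \<le> norm (adjoint G v)"
    using linear_inj_bounded_below_pos[OF la] by blast
  have quad: "v \<bullet> G (adjoint G v) = (norm (adjoint G v))\<^sup>2" for v
    using adjoint_works[OF G(1), of "adjoint G v" v] by (simp add: power2_norm_eq_inner inner_commute)
  have ge: "B \<le> s" if "s \<in> singular_values G" for s
  proof -
    from that obtain v where v: "0 \<le> s" "v \<noteq> 0" "G (adjoint G v) = s\<^sup>2 *\<^sub>R v"
      by (auto simp: singular_values_def)
    have "(B * norm v)\<^sup>2 \<le> (norm (adjoint G v))\<^sup>2" using B by (intro power_mono) auto
    also have "\<dots> = (s * norm v)\<^sup>2" unfolding quad[symmetric] v(3) by (simp add: power_mult_distrib power2_norm_eq_inner)
    finally have "B * norm v \<le> s * norm v" using v(1) by (meson mult_nonneg_nonneg norm_ge_zero power2_le_imp_le)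
    then show ?thesis using v(2) by simp
  qed
  have "v \<bullet> (G \<circ> adjoint G) w = (G \<circ> adjoint G) v \<bullet> w" for v w
    using adjoint_works[OF G(1), of "adjoint G w" v] adjoint_works[OF G(1), of "adjoint G v" w]
    by (simp add: inner_commute)
  then obtain v r where v: "norm v = 1" "(G \<circ> adjoint G) v = r *\<^sub>R v"
    using symmetric_form_has_eigenvalue[OF linear_compose[OF la G(1)]] by blast
  have "r = (norm (adjoint G v))\<^sup>2" using quad[of v] v by (simp add: dot_square_norm)
  then have "sqrt r \<in> singular_values G"
    using v by (auto simp: singular_values_def intro!: exI[of _ v])
  then have "B \<le> Inf (singular_values G)" using ge by (intro cInf_greatest) auto
  then show ?thesis using B(1) by (simp add: sigma_min_def)
qed

text \<open>Expanding a kernel vector in \<open>B\<close> turns the double sum into the form itself;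
  some coefficient is nonzero because the vector is.\<close>

lemma reduced_hessian_pos:
  fixes H :: "'a::euclidean_space \<Rightarrow> 'a" and G :: "'a \<Rightarrow> 'b::euclidean_space"
  assumes "reduced_hessian_ge G H \<gamma>" and "\<gamma> > 0" and H: "linear H" and w: "G w = 0" "w \<noteq> 0"
  shows "w \<bullet> H w > 0"
proof -
  from assms(1) obtain B where B: "finite B" "span B = {w. G w = 0}"
    and ge: "\<And>c. (\<Sum>b\<in>B. \<Sum>b'\<in>B. c b * c b' * (b \<bullet> H b')) \<ge> \<gamma> * (\<Sum>b\<in>B. (c b)\<^sup>2)"
    unfolding reduced_hessian_ge_def by blast
  obtain c where c: "w = (\<Sum>b\<in>B. c b *\<^sub>R b)"
    using B w span_finite[of B] by auto
  have "\<exists>b\<in>B. c b \<noteq> 0" using w(2) c by (metis (no_types, lifting) scaleR_zero_left sum.neutral)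
  then have "0 < (\<Sum>b\<in>B. (c b)\<^sup>2)" using B(1) by (auto intro!: sum_pos2)
  then have "0 < \<gamma> * (\<Sum>b\<in>B. (c b)\<^sup>2)" using \<open>\<gamma> > 0\<close> by simp
  also note ge
  also have "(\<Sum>b\<in>B. \<Sum>b'\<in>B. c b * c b' * (b \<bullet> H b')) = w \<bullet> H w"
    unfolding c by (simp add: linear_sum[OF H] linear_scale[OF H] inner_sum_left inner_sum_right sum_distrib_left mult.assoc)
      (subst sum.swap, simp add: mult.left_commute)
  finally show ?thesis .
qed

text \<open>Testing the first block equation with the primal part removes the multiplier term, so
  positivity on the kernel forces that part to vanish. Injectivity of the adjoint then removes the
  multiplier.\<close>

lemma inj_kkt_map:
  assumes H: "linear H" and G: "linear G" "surj G"
    and pos: "\<And>w. G w = 0 \<Longrightarrow> w \<noteq> 0 \<Longrightarrow> w \<bullet> H w > 0"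
  shows "inj (kkt_map H G)"
  unfolding linear_inj_iff_eq_0[OF linear_kkt_map[OF H G(1)]]
proof (intro allI impI)
  fix w assume "kkt_map H G w = 0"
  then have 1: "H (fst w) + adjoint G (snd w) = 0" and 2: "G (fst w) = 0"
    by (auto simp: kkt_map_def zero_prod_def)
  have "fst w \<bullet> H (fst w) = 0"
    using arg_cong[OF 1, of "(\<bullet>) (fst w)"] 2 by (simp add: inner_add_right adjoint_works[OF G(1)])
  then have "fst w = 0" using pos[OF 2] by force
  moreover have "inj (adjoint G)" using G by (simp add: linear_surj_adj_imp_inj)
  then have "snd w = 0" using 1 \<open>fst w = 0\<close>
    by (simp add: linear_0[OF H] linear_inj_iff_eq_0[OF adjoint_linear[OF G(1)]])
  ultimately show "w = 0" by (simp add: prod_eq_iff)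
qed

section \<open>Lower bounds for the constants in the accuracy threshold\<close>

text \<open>The final state enters the last dynamics constraint with identity coefficient, so a unit
  vector placed there has an image of norm at least 1.\<close>

lemma onorm_Gam_ge_1:
  fixes P :: "('x::finite, 'u::finite) ocp" and w :: "('n::finite, 'x, 'u) pd"
  assumes P: "smooth_ocp P CARD('n)"
    and H: "\<forall>k<CARD('n). symmetric_map (fst Hb k)" "symmetric_map (snd Hb)"
  shows "onorm (Gam P Hb w) \<ge> 1"
proof -
  obtain u :: "real ^ 'x" where u: "norm u = 1" using vector_choose_size[of 1] by auto
  define v :: "('n, 'x, 'u) pd" where "v = ((axis (stage CARD('n)) u, 0), 0)"
  obtain k where k: "CARD('n) = Suc k" using zero_less_card_finite[where 'a='n] gr0_conv_Suc by blast
  have "norm v = 1" using u by (simp add: v_def norm_Pair norm_eq_sqrt_inner inner_axis_axis)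
  have "xc (Suc k) (fst v) = u" by (simp add: v_def xc_def k axis_def)
  moreover have "xc k (fst v) = 0" using k by (simp add: v_def xc_def axis_def stage_inj)
  moreover have "uc k (fst v) = 0" using k by (simp add: v_def uc_def)
  ultimately have "jac_f P (fst w) (fst v) $ stage (Suc k) = u - (jac_A P k (zc k (fst w)) 0 + jac_B P k (zc k (fst w)) 0)"
    using k by (simp add: jac_f_stage[OF P])
  also have "\<dots> = u"
  proof -
    have "Ck 3 (dyn P k)" using P k by (simp add: smooth_ocp_def)
    from linear_0[OF has_derivative_linear[OF has_derivative_dyn[OF this, of "zc k (fst w)"]]]
    show ?thesis by simp
  qed
  finally have "1 \<le> norm (jac_f P (fst w) (fst v))" using u Finite_Cartesian_Product.norm_nth_le by metis
  also have "\<dots> \<le> norm (Gam P Hb w v)" by (simp add: Gam_def kkt_map_def norm_snd_le)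
  also have "\<dots> \<le> onorm (Gam P Hb w) * norm v"
    by (rule onorm) (use linear_Gam[OF P H] in \<open>simp add: linear_conv_bounded_linear\<close>)
  finally show ?thesis using \<open>norm v = 1\<close> by simp
qed

text \<open>The numerator is at least 20, and the denominator lies in \<open>(0, 1]\<close> because
  the Jacobian is surjective.\<close>

lemma Psi_ge_20:
  fixes P :: "('x::finite, 'u::finite) ocp" and w :: "('n::finite, 'x, 'u) pd"
  assumes P: "smooth_ocp P CARD('n)" and "gam_RH c > 0"
  shows "Psi P c Hb w \<ge> 20"
proof -
  have s: "sigma_min (jac_f P (fst w)) > 0" by (rule sigma_min_pos[OF linear_jac_f[OF P] surj_jac_f[OF P]])
  define d where "d = min (gam_RH c) 1 * min ((sigma_min (jac_f P (fst w)))\<^sup>2) 1"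
  have "0 < d" "d \<le> 1" using s assms(2) by (auto simp: d_def mult_le_one)
  then show ?thesis unfolding Psi_def d_def[symmetric] by (simp add: le_divide_eq) 
qed

lemma Upsilon_ge_1: "Upsilon P Hb w \<ge> 1"
  by (simp add: Upsilon_def)

section \<open>The gradient of the merit function\<close>

text \<open>\<open>Ck\<close> speaks of total derivatives in a fixed direction, so the two partial
  Jacobians are recombined before being differentiated again.\<close>

lemma jac_f_direction:
  fixes P :: "('x::finite, 'u::finite) ocp" and z :: "('n::finite, 'x, 'u) primal"
  assumes P: "smooth_ocp P CARD('n)" and k: "k < CARD('n)"
  shows "jac_A P k (zc k z) (xc k \<omega>) + jac_B P k (zc k z) (uc k \<omega>)
    = frechet_derivative (dyn P k) (at (zc k z)) (zc k \<omega>)"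
proof -
  have "Ck 3 (dyn P k)" using P k by (simp add: smooth_ocp_def)
  from frechet_derivative_at[OF has_derivative_dyn[OF this, of "zc k z"]]
  show ?thesis by (simp add: fun_eq_iff zc_def)
qed

lemma differentiable_frechet_derivative_zc:
  assumes "Ck 3 F"
  shows "(\<lambda>z. frechet_derivative F (at (zc k z)) v) differentiable (at z)"
  by (rule differentiable_compose[OF Ck_differentiable2[OF assms] bounded_linear_imp_differentiable[OF bounded_linear_zc]])

lemma differentiable_jac_f:
  fixes P :: "('x::finite, 'u::finite) ocp" and z :: "('n::finite, 'x, 'u) primal"
  assumes P: "smooth_ocp P CARD('n)"
  shows "(\<lambda>z. jac_f P z \<omega>) differentiable (at z)"
proof (rule differentiable_vecI)
  fix a :: "'n option"
  show "(\<lambda>z. jac_f P z \<omega> $ a) differentiable (at z)"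
  proof (cases "stage_no a")
    case 0
    then show ?thesis by (simp add: jac_f_stage[OF P])
  next
    case (Suc k)
    then have k: "k < CARD('n)" using stage_no_less[of a] by simp
    then have C: "Ck 3 (dyn P k)" using P by (simp add: smooth_ocp_def)
    show ?thesis using differentiable_frechet_derivative_zc[OF C, of k "zc k \<omega>" z]
      by (simp add: jac_f_stage[OF P] Suc jac_f_direction[OF P k])
  qed
qed

lemma has_derivative_total_cost:
  fixes P :: "('x::finite, 'u::finite) ocp" and z :: "('n::finite, 'x, 'u) primal"
  assumes P: "smooth_ocp P CARD('n)"
  shows "(total_cost P has_derivative (\<lambda>h. (\<Sum>k<CARD('n). frechet_derivative (cost P k) (at (zc k z)) (zc k h))
     + frechet_derivative (costN P) (at (xc CARD('n) z)) (xc CARD('n) h))) (at z)"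
proof -
  have D: "(F has_derivative frechet_derivative F (at x)) (at x)" if "Ck 3 F" for F :: "'c::euclidean_space \<Rightarrow> real" and x
    using Ck_differentiable[OF that] frechet_derivative_works by blast
  have 1: "((\<lambda>z. cost P k (zc k z)) has_derivative (\<lambda>h. frechet_derivative (cost P k) (at (zc k z)) (zc k h))) (at z)"
    if "k < CARD('n)" for k
    using P that by (intro has_derivative_compose[OF bounded_linear_imp_has_derivative[OF bounded_linear_zc] D]) (simp add: smooth_ocp_def)
  have 2: "((\<lambda>z. costN P (xc CARD('n) z)) has_derivative (\<lambda>h. frechet_derivative (costN P) (at (xc CARD('n) z)) (xc CARD('n) h))) (at z)"
    using P by (intro has_derivative_compose[OF bounded_linear_imp_has_derivative[OF bounded_linear_xc] D]) (simp add: smooth_ocp_def)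
  show ?thesis unfolding total_cost_def[abs_def]
    by (intro has_derivative_add has_derivative_sum 1 2) simp
qed

lemma differentiable_total_cost_derivative:
  fixes P :: "('x::finite, 'u::finite) ocp" and z :: "('n::finite, 'x, 'u) primal"
  assumes P: "smooth_ocp P CARD('n)"
  shows "(\<lambda>z. frechet_derivative (total_cost P) (at z) h) differentiable (at z)"
proof -
  have 1: "(\<lambda>z. frechet_derivative (cost P k) (at (zc k z)) (zc k h)) differentiable (at z)" if "k < CARD('n)" for k
    using P that by (intro differentiable_frechet_derivative_zc) (simp add: smooth_ocp_def)
  have 2: "(\<lambda>z. frechet_derivative (costN P) (at (xc CARD('n) z)) (xc CARD('n) h)) differentiable (at z)"
    using P by (intro differentiable_compose[OF Ck_differentiable2 bounded_linear_imp_differentiable[OF bounded_linear_xc]]) (simp add: smooth_ocp_def)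
  show ?thesis
    unfolding frechet_derivative_at[OF has_derivative_total_cost[OF P], symmetric]
    by (intro differentiable_add differentiable_sum ballI 1 2) simp_all
qed

lemma inner_grad_z:
  fixes P :: "('x::finite, 'u::finite) ocp" and w :: "('n::finite, 'x, 'u) pd"
  assumes P: "smooth_ocp P CARD('n)"
  shows "h \<bullet> grad_z P w = frechet_derivative (total_cost P) (at (fst w)) h + snd w \<bullet> jac_f P (fst w) h"
  unfolding grad_z_def
proof (rule inner_grad)
  have "(total_cost P has_derivative frechet_derivative (total_cost P) (at (fst w))) (at (fst w))"
    unfolding frechet_derivative_works[symmetric] by (rule differentiableI[OF has_derivative_total_cost[OF P]])
  then show "((\<lambda>z. lagr P (z, snd w)) has_derivative
      (\<lambda>h. frechet_derivative (total_cost P) (at (fst w)) h + snd w \<bullet> jac_f P (fst w) h)) (at (fst w))"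
    unfolding lagr_def
    by (auto intro!: has_derivative_add has_derivative_inner_right has_derivative_jac_f[OF P])
qed

lemma has_derivative_lagr:
  fixes P :: "('x::finite, 'u::finite) ocp" and w :: "('n::finite, 'x, 'u) pd"
  assumes P: "smooth_ocp P CARD('n)"
  shows "(lagr P has_derivative (\<lambda>h. h \<bullet> grad_L P w)) (at w)"
proof -
  have tc: "(total_cost P has_derivative frechet_derivative (total_cost P) (at (fst w))) (at (fst w))"
    unfolding frechet_derivative_works[symmetric] by (rule differentiableI[OF has_derivative_total_cost[OF P]])
  have fst: "(fst has_derivative fst) (at w)" and snd: "(snd has_derivative snd) (at w)"
    by (auto intro!: derivative_eq_intros)
  have "(lagr P has_derivative (\<lambda>h. frechet_derivative (total_cost P) (at (fst w)) (fst h)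
     + (snd w \<bullet> jac_f P (fst w) (fst h) + snd h \<bullet> constr P (fst w)))) (at w)"
    unfolding lagr_def[abs_def]
    by (intro has_derivative_add has_derivative_inner snd has_derivative_compose[OF fst tc]
        has_derivative_compose[OF fst has_derivative_jac_f[OF P]])
  also have "(\<lambda>h. frechet_derivative (total_cost P) (at (fst w)) (fst h)
     + (snd w \<bullet> jac_f P (fst w) (fst h) + snd h \<bullet> constr P (fst w))) = (\<lambda>h. h \<bullet> grad_L P w)"
    by (rule ext) (simp add: grad_L_def inner_prod_def[of _ "(_, _)"] inner_grad_z[OF P] grad_l_eq)
  finally show ?thesis .
qed

text \<open>Paired with a fixed vector, \<open>grad_z\<close> becomes a sum of directional
  derivatives of cost and constraints, which are differentiable by the smoothness of the
  data.\<close>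

lemma differentiable_grad_z:
  fixes P :: "('x::finite, 'u::finite) ocp" and w :: "('n::finite, 'x, 'u) pd"
  assumes P: "smooth_ocp P CARD('n)"
  shows "grad_z P differentiable (at w)"
proof (subst differentiable_componentwise_within, intro ballI)
  fix e :: "('n, 'x, 'u) primal"
  have fst: "fst differentiable (at w)" and snd: "snd differentiable (at w)"
    by (auto intro!: bounded_linear_imp_differentiable bounded_linear_fst bounded_linear_snd)
  have "(\<lambda>w. frechet_derivative (total_cost P) (at (fst w)) e + snd w \<bullet> jac_f P (fst w) e) differentiable (at w)"
    by (intro differentiable_add differentiable_inner snd
        differentiable_compose[OF differentiable_total_cost_derivative[OF P] fst]
        differentiable_compose[OF differentiable_jac_f[OF P] fst])
  then show "(\<lambda>w. grad_z P w \<bullet> e) differentiable (at w)"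
    by (simp add: inner_grad_z[OF P] inner_commute[of "grad_z P _"])
qed

text \<open>
  The linear form \<open>K\<close> is \<open>(\<nabla>\<^sup>2\<^sub>z L a, G a)\<close> for \<open>a = \<nabla>\<^sub>z L\<close>; only its dual component matters below.
\<close>

lemma inner_grad_merit:
  fixes P :: "('x::finite, 'u::finite) ocp" and w :: "('n::finite, 'x, 'u) pd"
  assumes P: "smooth_ocp P CARD('n)"
  obtains K where "linear K"
    and "\<And>l. K (0, l) = l \<bullet> jac_f P (fst w) (grad_z P w)"
    and "\<And>\<eta>1 \<eta>2 d. d \<bullet> grad (merit P \<eta>1 \<eta>2) w
           = d \<bullet> grad_L P w + \<eta>1 * (grad_l P w \<bullet> jac_f P (fst w) (fst d)) + \<eta>2 * K d"
proof -
  define a where "a = grad_z P w"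
  obtain D where D: "(grad_z P has_derivative D) (at w)"
    using differentiable_grad_z[OF P] unfolding differentiable_def by blast
  have linD: "linear D" using D by (rule has_derivative_linear)
  \<comment> \<open>The mixed second derivative of the Lagrangian is the constraint Jacobian. It is
    found by differentiating in the multiplier twice, by the chain rule and through the explicit
    formula, and comparing.\<close>
  have aD: "a \<bullet> D (0, l) = l \<bullet> jac_f P (fst w) a" for l
  proof -
    have w: "((\<lambda>l. (fst w, l)) has_derivative (\<lambda>l. (0, l))) (at (snd w))"
      by (auto intro!: derivative_eq_intros)
    have "((\<lambda>l. a \<bullet> grad_z P (fst w, l)) has_derivative (\<lambda>l. a \<bullet> D (0, l))) (at (snd w))"
      by (intro has_derivative_inner_right has_derivative_compose[OF w]) (simp add: D)
    moreover have "((\<lambda>l. a \<bullet> grad_z P (fst w, l)) has_derivative (\<lambda>l. l \<bullet> jac_f P (fst w) a)) (at (snd w))"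
      unfolding inner_grad_z[OF P] by (auto intro!: derivative_eq_intros)
    ultimately show ?thesis by (metis has_derivative_unique)
  qed
  have fst: "(fst has_derivative fst) (at w)" by (auto intro!: derivative_eq_intros)
  have "(merit P \<eta>1 \<eta>2 has_derivative (\<lambda>d. d \<bullet> grad_L P w
      + \<eta>1 / 2 * (constr P (fst w) \<bullet> jac_f P (fst w) (fst d) + jac_f P (fst w) (fst d) \<bullet> constr P (fst w))
      + \<eta>2 / 2 * (a \<bullet> D d + D d \<bullet> a))) (at w)" for \<eta>1 \<eta>2
    unfolding merit_def[abs_def] grad_l_eq power2_norm_eq_inner a_def
    by (intro has_derivative_add has_derivative_mult_right has_derivative_inner has_derivative_lagr[OF P] D
        has_derivative_compose[OF fst has_derivative_jac_f[OF P]])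
  from inner_grad[OF this]
  have "d \<bullet> grad (merit P \<eta>1 \<eta>2) w
      = d \<bullet> grad_L P w + \<eta>1 * (grad_l P w \<bullet> jac_f P (fst w) (fst d)) + \<eta>2 * (a \<bullet> D d)" for \<eta>1 \<eta>2 d
    by (simp add: grad_l_eq inner_commute)
  moreover have "linear (\<lambda>d. a \<bullet> D d)"
    by (rule linearI) (simp_all add: linear_add[OF linD] linear_scale[OF linD] inner_add_right)
  ultimately show thesis using that[of "\<lambda>d. a \<bullet> D d"] aD by (simp add: a_def)
qed

section \<open>Descent for small residuals\<close>

text \<open>Here \<open>t\<close> stands for \<open>1 / nu ^ m\<close>. The residual bound of order
  \<open>t ^ 4\<close> absorbs the growth \<open>1 / t^2\<close> of the first penalty and leaves an
  error of order \<open>t^2\<close>. This is enough even in the tightest case, where the factor 1/2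
  in the descent test leaves a margin of order \<open>t\<close>.\<close>

lemma eventually_descent:
  fixes H :: "'a::euclidean_space \<Rightarrow> 'a" and G :: "'a \<Rightarrow> 'b::euclidean_space" and K :: "'a \<times> 'b \<Rightarrow> real"
  assumes H: "linear H" and G: "linear G" "surj G"
    and pos: "\<And>w. G w = 0 \<Longrightarrow> w \<noteq> 0 \<Longrightarrow> w \<bullet> H w > 0"
    and K: "linear K" "\<And>l. K (0, l) = l \<bullet> G a"
    and ab: "(a, b) \<noteq> 0" and h: "h1 > 0" "h2 > 0" and R: "R \<ge> 0"
  shows "\<forall>\<^sub>F t in at_right 0. \<forall>v. norm (kkt_map H G v + (a, b)) \<le> R * t ^ 4 \<longrightarrow>
    v \<bullet> (a, b) + h1 / t\<^sup>2 * (b \<bullet> G (fst v)) + h2 * t * K v \<le> - (h2 * t * (norm (a, b))\<^sup>2 / 2)"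
proof -
  let ?\<Gamma> = "kkt_map H G" let ?n = "(norm (a, b))\<^sup>2"
  have lin: "linear ?\<Gamma>" by (rule linear_kkt_map[OF H G(1)])
  have inj: "inj ?\<Gamma>" by (rule inj_kkt_map[OF H G pos])
  obtain B where B: "B > 0" "\<And>v. B * norm v \<le> norm (?\<Gamma> v)"
    using linear_inj_bounded_below_pos[OF lin inj] by blast
  obtain d where d: "?\<Gamma> d = - (a, b)"
    using linear_injective_imp_surjective[OF lin inj] by (metis surjD)
  have da: "H (fst d) + adjoint G (snd d) = - a" and db: "G (fst d) = - b"
    using d by (auto simp: kkt_map_def)
  obtain k where k: "k > 0" "\<And>v. norm (K v) \<le> k * norm v"
    using linear_bounded_pos[OF K(1)] by blast
  obtain g where g: "g > 0" "\<And>v. norm (G v) \<le> g * norm v"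
    using linear_bounded_pos[OF G(1)] by blast
  define f where "f t v = v \<bullet> (a, b) + h1 / t\<^sup>2 * (b \<bullet> G (fst v)) + h2 * t * K v" for t v
  \<comment> \<open>\<open>R / B\<close> bounds the distance to the Newton direction
    \<open>d\<close> in units of \<open>t ^ 4\<close>; the bracket, divided by \<open>t^2\<close>,
    bounds the norm of the slope functional for \<open>t \<le> 1\<close>.\<close>
  define C where "C = (norm (a, b) + h1 * norm b * g + h2 * k) * (R / B)"
  have err: "f t v \<le> f t d + C * t\<^sup>2"
    if t: "0 < t" "t \<le> 1" and v: "norm (?\<Gamma> v + (a, b)) \<le> R * t ^ 4" for t v
  proof -
    define x where "x = v - d"
    have "?\<Gamma> x = ?\<Gamma> v + (a, b)" unfolding x_def by (simp only: linear_diff[OF lin] d) simp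
    then have "B * norm x \<le> R * t ^ 4" using B(2)[of x] v by simp
    then have x: "norm x \<le> (R / B) * t ^ 4" using B(1) by (simp add: field_simps)
    have "f t v = f t d + f t x"
      by (simp add: f_def x_def inner_diff_left inner_diff_right linear_diff[OF K(1)] linear_diff[OF G(1)] algebra_simps)
    moreover have "f t x \<le> (norm (a, b) + h1 * norm b * g + h2 * k) * (1 / t\<^sup>2) * norm x"
    proof -
      have it: "1 \<le> 1 / t\<^sup>2" using t by (simp add: power_le_one)
      have "x \<bullet> (a, b) \<le> norm x * norm (a, b)" by (rule norm_cauchy_schwarz)
      also have "\<dots> \<le> norm (a, b) * (1 / t\<^sup>2) * norm x"
        using mult_right_mono[OF it, of "norm x * norm (a, b)"] by (simp add: mult_ac)
      finally have 1: "x \<bullet> (a, b) \<le> norm (a, b) * (1 / t\<^sup>2) * norm x" .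
      have "b \<bullet> G (fst x) \<le> norm b * norm (G (fst x))" by (rule norm_cauchy_schwarz)
      also have "\<dots> \<le> norm b * (g * norm x)"
        by (intro mult_left_mono order_trans[OF g(2)]) (use g(1) norm_fst_le[of "fst x" "snd x"] in auto)
      finally have 2: "h1 / t\<^sup>2 * (b \<bullet> G (fst x)) \<le> h1 * norm b * g * (1 / t\<^sup>2) * norm x"
        using mult_left_mono[of "b \<bullet> G (fst x)" "norm b * (g * norm x)" "h1 / t\<^sup>2"] h t by (simp add: mult_ac)
      have "K x \<le> k * norm x" using k(2)[of x] by simp
      then have "t * K x \<le> t * (k * norm x)" using t by (intro mult_left_mono) auto
      also have "\<dots> \<le> 1 * (k * norm x)" using t k(1) by (intro mult_right_mono) auto
      also have "\<dots> \<le> k * (1 / t\<^sup>2) * norm x"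
        using mult_right_mono[OF it, of "k * norm x"] k(1) by (simp add: mult_ac)
      finally have "h2 * (t * K x) \<le> h2 * (k * (1 / t\<^sup>2) * norm x)" using h by (intro mult_left_mono) auto
      then have 3: "h2 * t * K x \<le> h2 * k * (1 / t\<^sup>2) * norm x" by (simp add: mult.assoc)
      show ?thesis using add_mono[OF add_mono[OF 1 2] 3] by (simp only: f_def distrib_right)
    qed
    moreover have "\<dots> \<le> (norm (a, b) + h1 * norm b * g + h2 * k) * (1 / t\<^sup>2) * ((R / B) * t ^ 4)"
      using x h k g t by (intro mult_left_mono) (auto intro!: add_nonneg_nonneg mult_nonneg_nonneg divide_nonneg_nonneg)
    moreover have "\<dots> = C * t\<^sup>2" using t by (simp add: C_def power_numeral_reduce power2_eq_square)
    ultimately show ?thesis by simp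
  qed
  have "\<forall>\<^sub>F t in at_right 0. f t d + C * t\<^sup>2 \<le> - (h2 * t * ?n / 2)"
  proof (cases "b = 0")
    case False
    \<comment> \<open>Multiplication by \<open>t^2\<close> turns the dominant term into the constant
      \<open>h1 * (norm b)^2\<close> and makes the remaining terms a continuous function vanishing
      at 0.\<close>
    define p where "p t = (d \<bullet> (a, b) + h2 * t * K d + C * t\<^sup>2 + h2 * t * ?n / 2) * t\<^sup>2" for t
    have "(p \<longlongrightarrow> p 0) (at_right 0)" unfolding p_def by (intro tendsto_intros) simp
    then have "\<forall>\<^sub>F t in at_right 0. p t < h1 * (norm b)\<^sup>2"
      by (rule order_tendstoD(2)) (use False h in \<open>simp add: p_def\<close>)
    then show ?thesis
      using eventually_at_right_less
    proof eventually_elim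
      case (elim t)
      then have "d \<bullet> (a, b) + h2 * t * K d + C * t\<^sup>2 + h2 * t * ?n / 2 \<le> h1 * (norm b)\<^sup>2 / t\<^sup>2"
        by (simp add: p_def pos_le_divide_eq)
      then show ?case by (simp add: f_def db power2_norm_eq_inner)
    qed
  next
    case True
    then have Gd: "G (fst d) = 0" using db by simp
    \<comment> \<open>The primal part lies in the kernel of \<open>G\<close>, so the multiplier term
      drops out and the slope of the Lagrangian is minus the reduced Hessian form.\<close>
    have "fst d \<bullet> (H (fst d) + adjoint G (snd d)) = fst d \<bullet> H (fst d)"
      using Gd by (simp add: inner_add_right adjoint_works[OF G(1)])
    then have dab: "d \<bullet> (a, b) = - (fst d \<bullet> H (fst d))" unfolding da using True by (simp add: inner_prod_def)
    show ?thesis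
    proof (cases "fst d = 0")
      case False
      \<comment> \<open>As \<open>b = 0\<close>, nothing grows with \<open>1 / t\<close>: all
        perturbations vanish in the limit against a fixed positive curvature.\<close>
      define p where "p t = h2 * t * K d + C * t\<^sup>2 + h2 * t * ?n / 2" for t
      have "(p \<longlongrightarrow> p 0) (at_right 0)" unfolding p_def by (intro tendsto_intros) simp
      then have "\<forall>\<^sub>F t in at_right 0. p t < fst d \<bullet> H (fst d)"
        by (rule order_tendstoD(2)) (use pos[OF Gd False] in \<open>simp add: p_def\<close>)
      then show ?thesis
        by eventually_elim (simp add: f_def dab Gd p_def)
    next
      case dz: True
      have "a \<noteq> 0" and n: "?n = a \<bullet> a" using ab True by (auto simp: norm_Pair power2_norm_eq_inner zero_prod_def)
      \<comment> \<open>Only the dual component of \<open>d\<close> is left, where \<open>K\<close>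
        is known explicitly; the Newton equation then identifies
        \<open>adjoint G (snd d)\<close>.\<close>
      have "K d = snd d \<bullet> G a" using K(2)[of "snd d"] dz by (metis prod.collapse)
      also have "\<dots> = a \<bullet> adjoint G (snd d)" by (simp add: adjoint_works[OF G(1)] inner_commute)
      also have "adjoint G (snd d) = - a" using da dz linear_0[OF H] by simp
      finally have Kd: "K d = - (a \<bullet> a)" by simp
      \<comment> \<open>The exact slope is twice the required one. The spare half is linear in
        \<open>t\<close> and eventually exceeds the quadratic error.\<close>
      have "((\<lambda>t. C * t) \<longlongrightarrow> C * 0) (at_right 0)" by (intro tendsto_intros)
      then have "\<forall>\<^sub>F t in at_right 0. C * t < h2 * (a \<bullet> a) / 2"
        by (rule order_tendstoD(2)) (use \<open>a \<noteq> 0\<close> h in simp)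
      then show ?thesis
        using eventually_at_right_less
      proof eventually_elim
        case (elim t)
        then have "C * t * t \<le> h2 * (a \<bullet> a) / 2 * t" by (intro mult_right_mono) auto
        then have "C * t\<^sup>2 \<le> h2 * (a \<bullet> a) / 2 * t" by (simp add: power2_eq_square mult.assoc)
        moreover have "f t d = - (h2 * t * (a \<bullet> a))"
          using linear_0[OF H] linear_0[OF G(1)] by (simp add: f_def dab Kd dz)
        ultimately show ?case unfolding n by (simp add: algebra_simps)
      qed
    qed
  qed
  moreover have "\<forall>\<^sub>F t in at_right 0. (0::real) < t \<and> t \<le> 1"
    unfolding eventually_at_right_field by (intro exI[of _ 1]) auto
  ultimately show ?thesis
  proof eventually_elim
    case (elim t)
    then show ?case using err[of t] unfolding f_def by (meson order_trans)
  qed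
qed

section \<open>The inner iterations\<close>

text \<open>\<open>owner\<close> is a definite description, so the cores must be shown to partition
  the stages. The owner is the largest index whose knot is at most \<open>k\<close>; the last core
  is closed at \<open>N\<close> and thus catches the final stage.\<close>

lemma owner_less:
  assumes c: "valid_params N c" and k: "k \<le> N"
  shows "owner N c k < parts c"
proof -
  have mono: "knot c i \<le> knot c j" if "i \<le> j" "j \<le> parts c" for i j
    using c that strict_mono_onD[of "{0..parts c}" "knot c" i j]
    by (cases "i = j") (auto simp: valid_params_def)
  have "\<exists>!i. i < parts c \<and> k \<in> core N c i"
  proof (rule ex_ex1I)
    define S where "S = {i. i < parts c \<and> knot c i \<le> k}"
    have "0 \<in> S" using c by (auto simp: S_def valid_params_def)
    have fin: "finite S" by (simp add: S_def)
    have M: "Max S \<in> S" using fin \<open>0 \<in> S\<close> by (metis Max_in empty_iff)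
    have "k < knot c (Max S + 1)" if "Max S < parts c - 1"
    proof (rule ccontr)
      assume "\<not> k < knot c (Max S + 1)"
      then have "Max S + 1 \<in> S" using that by (simp add: S_def)
      then show False using Max_ge[OF fin] by fastforce
    qed
    then show "\<exists>i. i < parts c \<and> k \<in> core N c i"
      using M k by (intro exI[of _ "Max S"]) (auto simp: S_def core_def)
  next
    have no: "False" if "i < j" "j < parts c" "k \<in> core N c i" "k \<in> core N c j" for i j
    proof -
      have "k < knot c (i + 1)" "knot c j \<le> k" using that by (auto simp: core_def split: if_splits)
      then show False using mono[of "i + 1" j] that by simp
    qed
    fix i j assume "i < parts c \<and> k \<in> core N c i" "j < parts c \<and> k \<in> core N c j"
    then show "i = j" using no[of i j] no[of j i] by (cases i j rule: linorder_cases) auto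
  qed
  from theI'[OF this] show ?thesis unfolding owner_def by simp
qed

text \<open>Each component is copied from one local solution, and which one does not vary along the
  filter.\<close>

lemma tendsto_composed:
  fixes y :: "'s \<Rightarrow> nat \<Rightarrow> ('n::finite, 'x::finite, 'u::finite) pd"
  assumes c: "valid_params CARD('n) c" and y: "\<And>i. i < parts c \<Longrightarrow> ((\<lambda>j. y j i) \<longlongrightarrow> d) F"
  shows "((\<lambda>j. composed c (y j)) \<longlongrightarrow> d) F"
proof -
  have o: "((\<lambda>j. y j (owner CARD('n) c k)) \<longlongrightarrow> d) F" if "k \<le> CARD('n)" for k
    using owner_less[OF c that] by (rule y)
  have o': "((\<lambda>j. y j (owner CARD('n) c (stage_no a))) \<longlongrightarrow> d) F" for a :: 'n
    by (rule o[OF less_imp_le[OF stage_no_less]])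
  have "((\<lambda>j. composed c (y j)) \<longlongrightarrow> ((\<chi> a. fst (fst d) $ a, \<chi> a. snd (fst d) $ a), \<chi> a. snd d $ a)) F"
    unfolding composed_def Let_def
    by (intro tendsto_Pair tendsto_vec_lambda tendsto_vec_nth tendsto_fst tendsto_snd o o' stage_no_le)
  then show ?thesis by (simp add: vec_lambda_eta)
qed

section \<open>Invariants of the inner iterations and the initial zero direction\<close>

lemma iterate_inner_state [simp]: "iterate (inner_state P c Hb y s J) = iterate s"
  by (induction J) (simp_all add: begin_iteration_def accuracy_pass_def penalty_update_def Let_def)

text \<open>Positivity keeps \<open>eps\<close> positive under every update. The bound by 1 follows
  from \<open>Psi * Upsilon\<close> being at least 20 and serves to reject the zero
  direction.\<close>

lemma eps_max_pos:
  fixes s :: "('n::finite, 'x::finite, 'u::finite) aotd_state"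
  assumes "smooth_ocp P CARD('n)" "valid_params CARD('n) c" "eta1 s > 0" "eta2 s > 0"
  shows "eps_max P c Hb s > 0" "eps_max P c Hb s < 1"
proof -
  define X where "X = Psi P c Hb (iterate s) * Upsilon P Hb (iterate s)"
  have "Psi P c Hb (iterate s) \<ge> 20" using assms by (intro Psi_ge_20) (simp_all add: valid_params_def)
  then have X: "X \<ge> 20 * 1" unfolding X_def using Upsilon_ge_1[of P Hb "iterate s"] by (intro mult_mono) auto
  have b: "beta c > 0" "beta c < 1/2" using assms by (auto simp: valid_params_def)
  have D: "eta2 s < (1 + eta1 s + eta2 s) * X\<^sup>2"
  proof -
    have "1 \<le> X\<^sup>2" using X by simp
    then have "(1 + eta1 s + eta2 s) * 1 \<le> (1 + eta1 s + eta2 s) * X\<^sup>2" using assms by (intro mult_left_mono) auto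
    then show ?thesis by (rule less_le_trans[rotated]) (use assms in simp)
  qed
  then have D0: "0 < (1 + eta1 s + eta2 s) * X\<^sup>2" using assms by linarith
  show "eps_max P c Hb s > 0" unfolding eps_max_def X_def[symmetric]
    using assms b D0 by (intro divide_pos_pos mult_pos_pos) auto
  have "(1/2 - beta c) * eta2 s \<le> 1 * eta2 s" using assms b by (intro mult_right_mono) auto
  then show "eps_max P c Hb s < 1" unfolding eps_max_def X_def[symmetric]
    using D D0 by (simp add: divide_less_eq)
qed

text \<open>The condition on the input parameters is also the loop invariant: updates scale
  tolerances and penalties by positive factors, or cap \<open>eps\<close> by a positive number, and
  overlaps only grow.\<close>

lemma valid_init_inner_state:
  fixes s :: "('n::finite, 'x::finite, 'u::finite) aotd_state"
  assumes P: "smooth_ocp P CARD('n)" and c: "valid_params CARD('n) c" and s: "valid_init c s"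
  shows "valid_init c (inner_state P c Hb y s J)"
proof (induction J)
  case 0
  have "eps_max P c Hb s > 0" using s by (intro eps_max_pos P c) (simp_all add: valid_init_def)
  then show ?case using s c by (simp add: valid_init_def begin_iteration_def valid_params_def)
next
  case (Suc J)
  define t where "t = inner_state P c Hb y s J"
  have t: "valid_init c t" using Suc by (simp add: t_def)
  have "valid_init c (accuracy_pass P c Hb (y J) t)"
    using t by (auto simp: valid_init_def accuracy_pass_def Let_def)
  moreover have "valid_init c (penalty_update P c Hb t)"
  proof -
    have nu: "nu c > 0" using c by (simp add: valid_params_def)
    have "eps_max P c Hb (t\<lparr>eta1 := (nu c)\<^sup>2 * eta1 t, eta2 := eta2 t / nu c\<rparr>) > 0"
      using t nu by (intro eps_max_pos P c) (simp_all add: valid_init_def)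
    then show ?thesis using t nu by (simp add: valid_init_def penalty_update_def Let_def)
  qed
  ultimately show ?case using t by (simp add: t_def[symmetric] Let_def)
qed

lemma valid_init_reaches:
  fixes s :: "('n::finite, 'x::finite, 'u::finite) aotd_state"
  assumes P: "smooth_ocp P CARD('n)" and c: "valid_params CARD('n) c"
    and "reaches P c Hm sol s0 \<tau> s" "valid_init c s0"
  shows "valid_init c s"
  using assms(3,4)
proof (induction rule: reaches.induct)
  case start
  then show ?case .
next
  case (step \<tau> s t m)
  then obtain j where "t = inner_state P c (Hm \<tau>) (sol \<tau>) s j" by (auto simp: accepted_def)
  then have "valid_init c t" using valid_init_inner_state[OF P c] step by simp
  then show ?case by (simp add: valid_init_def)
qed

text \<open>The first inner iteration is a pass, since accuracy fails initially. From then on the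
  direction changes only in passes, because penalty updates keep it.\<close>

lemma dirn_inner_state:
  assumes "\<not> accuracy P c Hb (inner_state P c Hb y s 0)" and "0 < J"
  shows "\<exists>j<J. dirn (inner_state P c Hb y s J) = composed c (y j)"
  using assms(2)
proof (induction J rule: nat_induct_non_zero)
  case 1
  then show ?case using assms(1) by (simp add: accuracy_pass_def Let_def)
next
  case (Suc J)
  then obtain j where "j < J" "dirn (inner_state P c Hb y s J) = composed c (y j)" by blast
  then show ?case
    by (auto simp: accuracy_pass_def penalty_update_def Let_def intro: exI[of _ J] exI[of _ j])
qed

text \<open>For the zero direction the residual is the full gradient, so accuracy would require
  \<open>onorm\<close> times \<open>Psi\<close>, which is at least 20, to be at most
  \<open>eps\<close>, which is below 1.\<close>

lemma not_accuracy_start: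
  fixes s :: "('n::finite, 'x::finite, 'u::finite) aotd_state"
  assumes P: "smooth_ocp P CARD('n)" and c: "valid_params CARD('n) c" and s: "valid_init c s"
    and H: "\<forall>k<CARD('n). symmetric_map (fst Hb k)" "symmetric_map (snd Hb)"
    and L: "grad_L P (iterate s) \<noteq> 0"
  shows "\<not> accuracy P c Hb (inner_state P c Hb y s 0)"
proof
  let ?t = "begin_iteration P c Hb s" let ?w = "iterate s"
  assume "accuracy P c Hb (inner_state P c Hb y s 0)"
  moreover have "iterate ?t = ?w" "dirn ?t = 0" by (simp_all add: begin_iteration_def)
  ultimately have le: "norm (grad_L P ?w) \<le> eps ?t * norm (grad_L P ?w) / (onorm (Gam P Hb ?w) * Psi P c Hb ?w)"
    by (simp add: accuracy_def resid_def linear_0[OF linear_Gam[OF P H]])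
  have "eps ?t < 1"
    using eps_max_pos[OF P c, of s Hb] s c
    by (auto simp: begin_iteration_def valid_init_def valid_params_def divide_less_eq)
  moreover have "1 * 20 \<le> onorm (Gam P Hb ?w) * Psi P c Hb ?w"
    using onorm_Gam_ge_1[OF P H, of ?w] Psi_ge_20[OF P, of c Hb ?w] c
    by (intro mult_mono) (auto simp: valid_params_def)
  moreover have "norm (grad_L P ?w) * (onorm (Gam P Hb ?w) * Psi P c Hb ?w) \<le> eps ?t * norm (grad_L P ?w)"
    using le calculation by (simp add: pos_le_divide_eq)
  then have "onorm (Gam P Hb ?w) * Psi P c Hb ?w \<le> eps ?t" using L by (simp add: mult.commute)
  ultimately show False by linarith
qed

section \<open>Finite termination of the two nested loops\<close>

text \<open>If accuracy failed from \<open>J0\<close> on, every later inner iteration would be a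
  pass, so the threshold would stay fixed while the residual tends to 0. An arbitrary
  \<open>J0\<close> allows reuse after each penalty update.\<close>

lemma accuracy_loop_terminates:
  fixes s :: "('n::finite, 'x::finite, 'u::finite) aotd_state"
  assumes P: "smooth_ocp P CARD('n)" and c: "valid_params CARD('n) c" and s: "valid_init c s"
    and H: "\<forall>k<CARD('n). symmetric_map (fst Hb k)" "symmetric_map (snd Hb)"
    and inj: "inj (Gam P Hb (iterate s))"
    and L: "grad_L P (iterate s) \<noteq> 0"
    and sol: "\<And>J i. i < parts c \<Longrightarrow> \<not> accuracy P c Hb (inner_state P c Hb y s J) \<Longrightarrow>
       local_solution P c Hb (iterate s) i (ovl (inner_state P c Hb y s J) i) (eps_loc (inner_state P c Hb y s J) i) (y J i)"
  shows "\<exists>J\<ge>J0. accuracy P c Hb (inner_state P c Hb y s J)"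
proof (rule ccontr)
  let ?w = "iterate s"
  let ?\<Gamma> = "Gam P Hb ?w" let ?g = "grad_L P ?w"
  define t where "t J = inner_state P c Hb y s (J0 + J)" for J
  assume "\<not> ?thesis"
  then have nacc: "\<not> accuracy P c Hb (t J)" for J by (simp add: t_def)
  have lin: "linear ?\<Gamma>" by (rule linear_Gam[OF P H])
  have w: "iterate (t J) = ?w" for J by (simp add: t_def)
  have vi: "valid_init c (t J)" for J unfolding t_def by (rule valid_init_inner_state[OF P c s])
  have M: "parts c \<ge> 1" and re: "rho_e c > 0" using c by (auto simp: valid_params_def)
  \<comment> \<open>The part of the contraction factor that does not depend on the share
    \<open>q\<close> of the residual; as \<open>q\<close> is nonnegative, the actual factor is no
    larger.\<close>
  define \<rho> where "\<rho> = exp (- rho_e c * (1 / sqrt (real (parts c))))"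
  have \<rho>: "0 \<le> \<rho>" "\<rho> < 1" using M re by (simp_all add: \<rho>_def)
  have "t (Suc J) = accuracy_pass P c Hb (y (J0 + J)) (t J)" for J
    using nacc[of J] by (simp add: t_def Let_def)
  note step = this
  have step': "dirn (t (Suc J)) = composed c (y (J0 + J))" "eps (t (Suc J)) = eps (t J)"
    "ovl (t J) i < ovl (t (Suc J)) i"
    "i < parts c \<Longrightarrow> eps_loc (t (Suc J)) i \<le> eps_loc (t J) i * \<rho>" for J i
  proof -
    let ?s' = "t J\<lparr>dirn := composed c (y (J0 + J))\<rparr>"
    define q where "q = norm (restrict_stages (core CARD('n) c i) (resid P Hb ?s')) / norm (resid P Hb ?s')"
    have "q \<ge> 0" by (simp add: q_def)
    \<comment> \<open>Were the new direction accurate, the pass would end in an accurate state.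
      Hence the branch that updates tolerances and overlaps is taken.\<close>
    have "\<not> accuracy P c Hb ?s'" using nacc[of "Suc J"] unfolding step by (auto simp: accuracy_pass_def Let_def)
    then have 1: "dirn (t (Suc J)) = composed c (y (J0 + J))" "eps (t (Suc J)) = eps (t J)"
      and 2: "ovl (t (Suc J)) i = ovl (t J) i + max 1 (nat \<lceil>rho_b c * q\<rceil>)"
      and 3: "eps_loc (t (Suc J)) i = eps_loc (t J) i * exp (- rho_e c * (q + 1 / sqrt (real (parts c))))"
      unfolding step by (simp_all add: accuracy_pass_def Let_def q_def)
    show "dirn (t (Suc J)) = composed c (y (J0 + J))" "eps (t (Suc J)) = eps (t J)" by (fact 1)+
    show "ovl (t J) i < ovl (t (Suc J)) i" unfolding 2 by simp
    assume "i < parts c"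
    then have "eps_loc (t J) i \<ge> 0" using vi[of J] by (simp add: valid_init_def less_imp_le)
    moreover have "exp (- rho_e c * (q + 1 / sqrt (real (parts c)))) \<le> \<rho>"
      unfolding \<rho>_def using re \<open>q \<ge> 0\<close> by (simp add: distrib_left)
    ultimately show "eps_loc (t (Suc J)) i \<le> eps_loc (t J) i * \<rho>" unfolding 3 by (intro mult_left_mono)
  qed
  have eps: "eps (t J) = eps (t 0)" for J by (induction J) (simp_all add: step')
  have ovl: "J \<le> ovl (t J) i" for J i
    by (induction J) (use step'(3) in \<open>auto intro: Suc_leI le_less_trans\<close>)
  have loc: "eps_loc (t J) i \<le> eps_loc (t 0) i * \<rho> ^ J" if "i < parts c" for J i
  proof (induction J)
    case (Suc J)
    have "eps_loc (t (Suc J)) i \<le> eps_loc (t J) i * \<rho>" by (rule step'(4)[OF that])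
    also have "\<dots> \<le> eps_loc (t 0) i * \<rho> ^ J * \<rho>" using Suc \<rho> by (intro mult_right_mono)
    finally show ?case by (simp add: mult_ac)
  qed simp
  obtain d where d: "?\<Gamma> d = - ?g" using linear_injective_imp_surjective[OF lin inj] by (metis surjD)
  obtain B where B: "B > 0" "\<And>v. B * norm v \<le> norm (?\<Gamma> v)"
    using linear_inj_bounded_below_pos[OF lin inj] by blast
  have y: "(\<lambda>J. y (J0 + J) i) \<longlonglongrightarrow> d" if i: "i < parts c" for i
  proof (rule LIM_zero_cancel, rule Lim_null_comparison)
    \<comment> \<open>After \<open>N\<close> passes each local test is the global residual test, and
      nonsingularity converts its geometrically decreasing residual into distance from
      \<open>d\<close>.\<close>
    show "\<forall>\<^sub>F J in sequentially. norm (y (J0 + J) i - d) \<le> eps_loc (t 0) i * \<rho> ^ J * norm ?g / B"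
      using eventually_ge_at_top[of "CARD('n)"]
    proof eventually_elim
      case (elim J)
      have "local_solution P c Hb ?w i (ovl (t J) i) (eps_loc (t J) i) (y (J0 + J) i)"
        unfolding t_def by (rule sol[OF i]) (use nacc[of J] in \<open>simp add: t_def\<close>)
      then have "norm (?\<Gamma> (y (J0 + J) i) + ?g) \<le> eps_loc (t J) i * norm ?g"
        using local_solution_full_window[OF P H c i order_trans[OF elim ovl]] by blast
      also have "\<dots> \<le> eps_loc (t 0) i * \<rho> ^ J * norm ?g" using loc[OF i] by (intro mult_right_mono) auto
      finally have "B * norm (y (J0 + J) i - d) \<le> eps_loc (t 0) i * \<rho> ^ J * norm ?g"
        using B(2)[of "y (J0 + J) i - d"] by (simp add: linear_diff[OF lin] d)
      then show ?case using B(1) by (simp add: pos_le_divide_eq mult.commute)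
    qed
    have "(\<lambda>J. eps_loc (t 0) i * \<rho> ^ J * norm ?g / B) \<longlonglongrightarrow> eps_loc (t 0) i * 0 * norm ?g / B"
      using \<rho> B(1) by (intro tendsto_intros LIMSEQ_power_zero) auto
    then show "(\<lambda>J. eps_loc (t 0) i * \<rho> ^ J * norm ?g / B) \<longlonglongrightarrow> 0" by simp
  qed
  have "bounded_linear ?\<Gamma>" using lin by (simp add: linear_conv_bounded_linear)
  then have "(\<lambda>J. ?\<Gamma> (composed c (y (J0 + J))) + ?g) \<longlonglongrightarrow> ?\<Gamma> d + ?g"
    by (intro tendsto_intros bounded_linear.tendsto[of ?\<Gamma>] tendsto_composed[OF c] y)
  then have "(\<lambda>J. norm (?\<Gamma> (composed c (y (J0 + J))) + ?g)) \<longlonglongrightarrow> 0"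
    unfolding d by (simp add: tendsto_norm_zero_iff)
  moreover have "0 < eps (t 0) * norm ?g / (onorm ?\<Gamma> * Psi P c Hb ?w)"
  proof -
    have "onorm ?\<Gamma> > 0" using onorm_Gam_ge_1[OF P H, of ?w] by linarith
    moreover have "Psi P c Hb ?w > 0" using Psi_ge_20[OF P, of c Hb ?w] c by (simp add: valid_params_def)
    ultimately show ?thesis using vi[of 0] L by (simp add: valid_init_def)
  qed
  ultimately have "\<forall>\<^sub>F J in sequentially. norm (?\<Gamma> (composed c (y (J0 + J))) + ?g)
      < eps (t 0) * norm ?g / (onorm ?\<Gamma> * Psi P c Hb ?w)"
    by (rule order_tendstoD(2))
  then obtain J where "norm (?\<Gamma> (composed c (y (J0 + J))) + ?g)
      < eps (t 0) * norm ?g / (onorm ?\<Gamma> * Psi P c Hb ?w)"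
    by (auto dest: eventually_happens)
  \<comment> \<open>The direction composed in pass \<open>J\<close> is carried by the state with
    index \<open>Suc J\<close>.\<close>
  then have "accuracy P c Hb (t (Suc J))"
    by (simp add: accuracy_def resid_def w step'(1) eps[of "Suc J"])
  then show False using nacc by blast
qed

text \<open>When descent always fails, each accurate state triggers an update, and the scaling
  factors accumulate. For \<open>eps\<close> only an upper bound holds, because the cap may lower it
  further.\<close>

lemma penalty_updates:
  fixes P :: "('x::finite, 'u::finite) ocp" and s :: "('n::finite, 'x, 'u) aotd_state" and c Hb y
  defines "st \<equiv> inner_state P c Hb y s"
  assumes loop: "\<And>J0. \<exists>J\<ge>J0. accuracy P c Hb (st J)" and nu: "nu c > 1"
    and never: "\<And>J. accuracy P c Hb (st J) \<Longrightarrow> \<not> descent P (st J)"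
  shows "\<exists>J. accuracy P c Hb (st J) \<and> eta1 (st J) = (nu c) ^ (2 * m) * eta1 s \<and>
    eta2 (st J) = eta2 s / (nu c) ^ m \<and> eps (st J) \<le> eps (st 0) / (nu c) ^ (4 * m)"
proof -
  have next_acc: "\<exists>J. accuracy P c Hb (st J) \<and> eta1 (st J) = eta1 (st J0) \<and>
      eta2 (st J) = eta2 (st J0) \<and> eps (st J) = eps (st J0)" for J0
  proof -
    have ex: "\<exists>k. accuracy P c Hb (st (J0 + k))" using loop[of J0] le_Suc_ex by blast
    \<comment> \<open>The first accurate state from \<open>J0\<close> on: all steps before it are
      passes, which leave the penalties and \<open>eps\<close> unchanged.\<close>
    define k where "k = (LEAST k. accuracy P c Hb (st (J0 + k)))"
    have same: "eta1 (st (J0 + i)) = eta1 (st J0) \<and> eta2 (st (J0 + i)) = eta2 (st J0) \<and>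
        eps (st (J0 + i)) = eps (st J0)" if "i \<le> k" for i
      using that
    proof (induction i)
      case (Suc i)
      then have "\<not> accuracy P c Hb (st (J0 + i))" using not_less_Least[of i "\<lambda>k. accuracy P c Hb (st (J0 + k))"] unfolding k_def by simp
      then have "st (J0 + Suc i) = accuracy_pass P c Hb (y (J0 + i)) (st (J0 + i))"
        by (simp add: st_def Let_def)
      then show ?case using Suc by (simp add: accuracy_pass_def Let_def)
    qed simp
    have "accuracy P c Hb (st (J0 + k))" unfolding k_def using ex by (rule LeastI_ex)
    then show ?thesis using same[of k] by blast
  qed
  show ?thesis
  proof (induction m)
    case 0
    have "eta1 (st 0) = eta1 s" "eta2 (st 0) = eta2 s" by (simp_all add: st_def begin_iteration_def)
    then show ?case using next_acc[of 0] by auto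
  next
    case (Suc m)
    then obtain J where J: "accuracy P c Hb (st J)" "eta1 (st J) = (nu c) ^ (2 * m) * eta1 s"
      "eta2 (st J) = eta2 s / (nu c) ^ m" "eps (st J) \<le> eps (st 0) / (nu c) ^ (4 * m)" by blast
    have "st (Suc J) = penalty_update P c Hb (st J)"
      using J(1) never[OF J(1)] by (simp add: st_def Let_def)
    then have "eta1 (st (Suc J)) = (nu c)\<^sup>2 * eta1 (st J)" "eta2 (st (Suc J)) = eta2 (st J) / nu c"
      and e: "eps (st (Suc J)) \<le> eps (st J) / nu c ^ 4"
      by (simp_all add: penalty_update_def Let_def)
    moreover have "eps (st (Suc J)) \<le> eps (st 0) / (nu c) ^ (4 * Suc m)"
    proof -
      have "eps (st J) / nu c ^ 4 \<le> eps (st 0) / (nu c) ^ (4 * m) / nu c ^ 4"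
        using J(4) nu by (intro divide_right_mono) auto
      also have "\<dots> = eps (st 0) / (nu c) ^ (4 * Suc m)" by (simp add: power_add mult.commute)
      finally show ?thesis using e by linarith
    qed
    ultimately have "eta1 (st (Suc J)) = (nu c) ^ (2 * Suc m) * eta1 s \<and>
      eta2 (st (Suc J)) = eta2 s / (nu c) ^ Suc m \<and> eps (st (Suc J)) \<le> eps (st 0) / (nu c) ^ (4 * Suc m)"
      using J(2,3) by (simp add: power2_eq_square mult.commute)
    then show ?case using next_acc[of "Suc J"] by metis
  qed
qed

text \<open>If descent kept failing, the penalties would be driven arbitrarily far, into the regime
  where \<open>eventually_descent\<close> forces every accurate direction to descend.\<close>

lemma accuracy_and_descent_reached:
  fixes s :: "('n::finite, 'x::finite, 'u::finite) aotd_state"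
  assumes P: "smooth_ocp P CARD('n)" and c: "valid_params CARD('n) c" and s: "valid_init c s"
    and H: "\<forall>k<CARD('n). symmetric_map (fst Hb k)" "symmetric_map (snd Hb)"
    and red: "reduced_hessian_ge (jac_f P (fst (iterate s))) (block_diag Hb) (gam_RH c)"
    and L: "grad_L P (iterate s) \<noteq> 0"
    and sol: "\<And>J i. i < parts c \<Longrightarrow> \<not> accuracy P c Hb (inner_state P c Hb y s J) \<Longrightarrow>
       local_solution P c Hb (iterate s) i (ovl (inner_state P c Hb y s J) i) (eps_loc (inner_state P c Hb y s J) i) (y J i)"
  shows "\<exists>J. accuracy P c Hb (inner_state P c Hb y s J) \<and> descent P (inner_state P c Hb y s J)"
proof (rule ccontr)
  assume "\<not> ?thesis"
  then have never: "\<And>J. accuracy P c Hb (inner_state P c Hb y s J) \<Longrightarrow> \<not> descent P (inner_state P c Hb y s J)"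
    by blast
  define w where "w = iterate s"
  define a b where "a = grad_z P w" and "b = grad_l P w"
  let ?G = "jac_f P (fst w)" let ?H = "block_diag Hb :: ('n, 'x, 'u) primal \<Rightarrow> _"
  have g: "grad_L P w = (a, b)" by (simp add: grad_L_def a_def b_def)
  have \<Gamma>: "Gam P Hb w = kkt_map ?H ?G" by (simp add: Gam_def)
  have linH: "linear ?H" by (rule linear_block_diag) (use H in \<open>auto simp: symmetric_map_def\<close>)
  have linG: "linear ?G" and surjG: "surj ?G" by (rule linear_jac_f[OF P] surj_jac_f[OF P])+
  have "gam_RH c > 0" and nu: "nu c > 1" using c by (simp_all add: valid_params_def)
  then have pos: "\<And>v. ?G v = 0 \<Longrightarrow> v \<noteq> 0 \<Longrightarrow> v \<bullet> ?H v > 0"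
    using reduced_hessian_pos[OF red[folded w_def] _ linH] by blast
  have inj: "inj (Gam P Hb w)" unfolding \<Gamma> by (rule inj_kkt_map[OF linH linG surjG pos])
  obtain K where K: "linear K" "\<And>l. K (0, l) = l \<bullet> ?G a"
    and merit: "\<And>\<eta>1 \<eta>2 d. d \<bullet> grad (merit P \<eta>1 \<eta>2) w = d \<bullet> (a, b) + \<eta>1 * (b \<bullet> ?G (fst d)) + \<eta>2 * K d"
    using inner_grad_merit[OF P, of w] unfolding g a_def[symmetric] b_def[symmetric] by blast
  define e0 where "e0 = eps (inner_state P c Hb y s 0)"
  define D where "D = onorm (Gam P Hb w) * Psi P c Hb w"
  have "e0 > 0" using valid_init_inner_state[OF P c s] unfolding e0_def valid_init_def by blast
  have "D > 0"
    using onorm_Gam_ge_1[OF P H, of w] Psi_ge_20[OF P \<open>gam_RH c > 0\<close>, of Hb w] unfolding D_def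
    by (intro mult_pos_pos) auto
  \<comment> \<open>The accuracy threshold for the initial \<open>eps\<close>; after
    \<open>m\<close> updates the threshold is at most \<open>R\<close> times the fourth power of
    \<open>(1 / nu c) ^ m\<close>.\<close>
  define R where "R = e0 * norm (a, b) / D"
  have "R \<ge> 0" using \<open>e0 > 0\<close> \<open>D > 0\<close> by (simp add: R_def)
  have h: "eta1 s > 0" "eta2 s > 0" using s by (simp_all add: valid_init_def)
  have ev: "\<forall>\<^sub>F t in at_right 0. \<forall>v. norm (Gam P Hb w v + (a, b)) \<le> R * t ^ 4 \<longrightarrow>
      v \<bullet> (a, b) + eta1 s / t\<^sup>2 * (b \<bullet> ?G (fst v)) + eta2 s * t * K v \<le> - (eta2 s * t * (norm (a, b))\<^sup>2 / 2)"
    unfolding \<Gamma>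
    by (rule eventually_descent[OF linH linG surjG pos K _ h \<open>R \<ge> 0\<close>]) (use L in \<open>simp_all add: w_def g[unfolded w_def]\<close>)
  \<comment> \<open>These powers approach 0 through positive values, so the statement about small
    \<open>t\<close> holds for some update count \<open>m\<close>.\<close>
  have "filterlim (\<lambda>m. (1 / nu c) ^ m) (at_right 0) sequentially"
    unfolding filterlim_at using nu by (auto intro!: LIMSEQ_power_zero)
  from eventually_happens'[OF sequentially_bot eventually_compose_filterlim[OF ev this]] obtain m where
    m: "\<And>v. norm (Gam P Hb w v + (a, b)) \<le> R * ((1 / nu c) ^ m) ^ 4 \<Longrightarrow>
      v \<bullet> (a, b) + eta1 s / ((1 / nu c) ^ m)\<^sup>2 * (b \<bullet> ?G (fst v)) + eta2 s * (1 / nu c) ^ m * K v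
        \<le> - (eta2 s * (1 / nu c) ^ m * (norm (a, b))\<^sup>2 / 2)"
    by blast
  have loop: "\<exists>J\<ge>J0. accuracy P c Hb (inner_state P c Hb y s J)" for J0
    using accuracy_loop_terminates[OF P c s H inj[unfolded w_def] L sol] .
  from penalty_updates[of P c Hb y s m, OF loop nu never] obtain t where
    t: "iterate t = w" "accuracy P c Hb t" "\<not> descent P t" "eta1 t = nu c ^ (2 * m) * eta1 s"
      "eta2 t = eta2 s / nu c ^ m" "eps t \<le> e0 / nu c ^ (4 * m)"
    unfolding e0_def w_def using never iterate_inner_state by metis
  have "norm (Gam P Hb w (dirn t) + (a, b)) \<le> eps t * norm (a, b) / D"
    using t(1,2) by (simp add: accuracy_def resid_def g D_def)
  also have "\<dots> \<le> e0 / nu c ^ (4 * m) * norm (a, b) / D"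
    using t(6) \<open>D > 0\<close> by (intro divide_right_mono mult_right_mono) auto
  also have "\<dots> = R * ((1 / nu c) ^ m) ^ 4" by (simp add: R_def power_divide power_mult[symmetric] mult.commute)
  finally have "dirn t \<bullet> (a, b) + eta1 t * (b \<bullet> ?G (fst (dirn t))) + eta2 t * K (dirn t) \<le> - (eta2 t * (norm (a, b))\<^sup>2 / 2)"
    using m[of "dirn t"] unfolding t(4,5) by (simp add: power_divide power_mult[symmetric] mult.commute)
  then have "descent P t" unfolding descent_def t(1) g inner_commute[of _ "dirn t"] merit .
  then show False using t(3) by blast
qed

text \<open>The witness \<open>j\<close> records that the tested direction was composed from local
  solves of this outer iteration and is not the zero vector it was initialised with.\<close>

theorem corollary1:
  fixes P :: "('x::finite, 'u::finite) ocp"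
    and c :: aotd_params
    and s0 s :: "('n::finite, 'x, 'u) aotd_state"
    and Hm :: "nat \<Rightarrow> ('x, 'u) hblocks"
    and sol :: "nat \<Rightarrow> nat \<Rightarrow> nat \<Rightarrow> ('n, 'x, 'u) pd"
    and \<gamma>C \<Upsilon> :: real and tC \<tau> :: nat
  assumes "valid_params CARD('n) c"
    and "valid_init c s0"
    and "hessian_modification P c Hm sol s0"
    and "local_solves_ok P c Hm sol s0"
    and "reduced_hessian_assm P c Hm sol s0"
    and "controllability_assm P c Hm sol s0 \<gamma>C tC"
    and "boundedness_assm P c Hm sol s0 \<Upsilon>"
    and "smooth_compact_assm P c Hm sol s0 \<Upsilon>"
    and "mu c \<ge> 32 * \<Upsilon> ^ (4 * tC + 1) / \<gamma>C"
    and "reaches P c Hm sol s0 \<tau> s"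
    and "\<not> norm (grad_L P (iterate s)) \<le> tol_kkt c"
  shows "\<exists>J j t. t = inner_state P c (Hm \<tau>) (sol \<tau>) s J \<and>
           j < J \<and> dirn t = composed c (sol \<tau> j) \<and>
           accuracy P c (Hm \<tau>) t \<and> descent P t"
proof -
  note c = assms(1) and reach = assms(10)
  have P: "smooth_ocp P CARD('n)" using assms(8) by (simp add: smooth_compact_assm_def smooth_ocp_def)
  have s: "valid_init c s" by (rule valid_init_reaches[OF P c reach assms(2)])
  have H: "\<forall>k<CARD('n). symmetric_map (fst (Hm \<tau>) k)" "symmetric_map (snd (Hm \<tau>))"
    using assms(3) reach by (auto simp: hessian_modification_def)
  have red: "reduced_hessian_ge (jac_f P (fst (iterate s))) (block_diag (Hm \<tau>)) (gam_RH c)"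
    using assms(5) reach by (auto simp: reduced_hessian_assm_def)
  \<comment> \<open>A nonnegative tolerance turns the failed stopping test into a nonzero
    gradient.\<close>
  have "tol_kkt c \<ge> 0" using c by (simp add: valid_params_def)
  then have L: "grad_L P (iterate s) \<noteq> 0" using assms(11) by auto
  have sol: "local_solution P c (Hm \<tau>) (iterate s) i (ovl (inner_state P c (Hm \<tau>) (sol \<tau>) s J) i)
      (eps_loc (inner_state P c (Hm \<tau>) (sol \<tau>) s J) i) (sol \<tau> J i)"
    if "i < parts c" "\<not> accuracy P c (Hm \<tau>) (inner_state P c (Hm \<tau>) (sol \<tau>) s J)" for J i
    using assms(4,11) reach that unfolding local_solves_ok_def Let_def not_le iterate_inner_state by blast
  obtain J where J: "accuracy P c (Hm \<tau>) (inner_state P c (Hm \<tau>) (sol \<tau>) s J)"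
      "descent P (inner_state P c (Hm \<tau>) (sol \<tau>) s J)"
    using accuracy_and_descent_reached[OF P c s H red L sol] by blast
  \<comment> \<open>The initial state is not accurate, so the accurate state found comes after at
    least one pass and carries a composed direction.\<close>
  note start = not_accuracy_start[OF P c s H L, of "sol \<tau>"]
  have "0 < J" using J(1) start by (metis gr0I)
  from dirn_inner_state[OF start this] show ?thesis using J by blast
qed

end
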